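(* Let $G=\mathrm{SL}(n)$ or $G=\mathrm{Sp}(2s)$ (for $n=2s$). For any $p\ge 1$, if $f$ is a $G$-invariant in $T(V)$ of degree greater than $n(p-1)$, then $f\in I_{p+1}$.
   Context: $V$ is a finite-dimensional vector space over $\mathbb C$ with basis $X=\{x_1,\dots,x_n\}$. $T(V)=\mathbb C\langle X\rangle$ is the tensor algebra of $V$, i.e. the free associative algebra on $X$; degree means total degree (each $x_i$ of degree $1$). Left-normed commutators: $[u_1,u_2]=u_1u_2-u_2u_1$ and $[u_1,\dots,u_i]=[[u_1,\dots,u_{i-1}],u_i]$ for $i\ge 3$. For $m\ge 2$, $I_m$ is the two-sided ideal of $\mathbb C\langle X\rangle$ generated by all commutators $[u_1,\dots,u_m]$ with $u_1,\dots,u_m\in\mathbb C\langle X\rangle$. $\mathrm{GL}(V,\mathbb C)$ acts on $T(V)$ diagonally by algebra automorphisms. $\mathrm{SL}(n)=\mathrm{SL}(V,\mathbb C)$, and for $n=2s$, $\mathrm{Sp}(2s)=\mathrm{Sp}(V,\mathbb C)$ is the subgroup preserving a fixed non-degenerate skew-symmetric bilinear form on $V$.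
   Formalization: Assumes n ≥ 2 (for n = 1, SL(1) is trivial, I_{p+1} = 0 and x^p is a counterexample) and takes f homogeneous of degree > n(p-1) (1 plus a high-degree invariant is not in I_{p+1}). *)

theory Defs
  imports "HOL-Analysis.Analysis" "HOL-Library.Poly_Mapping"
begin

datatype 'x free_monoid = FM (letters: "'x list")

text \<open>The free monoid is written additively, because the product on \<open>\<Rightarrow>\<^sub>0\<close>
  is the convolution over an additive (not necessarily commutative) monoid of exponents.\<close>

instantiation free_monoid :: (type) monoid_add
begin

definition zero_free_monoid_def: "0 = FM []"

definition plus_free_monoid_def: "u + v = FM (letters u @ letters v)"

instance
  by standard (simp_all add: zero_free_monoid_def plus_free_monoid_def)

end

text \<open>\<open>'x free_alg\<close> is the monoid algebra over the complex numbers of the free monoid on \<open>'x\<close>,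
  hence an instance of \<^class>\<open>ring_1\<close>. For a finite type \<open>'n\<close> with \<open>n\<close> elements, the space
  \<open>V\<close> is \<open>complex ^ 'n\<close>, and its standard basis is the set of generators.\<close>

type_synonym 'x free_alg = "'x free_monoid \<Rightarrow>\<^sub>0 complex"

definition fa_scale :: "complex \<Rightarrow> 'x free_alg \<Rightarrow> 'x free_alg" where
  "fa_scale c f = Poly_Mapping.single 0 c * f"

definition fa_var :: "'x \<Rightarrow> 'x free_alg" where
  "fa_var i = Poly_Mapping.single (FM [i]) 1"

definition fa_vec :: "complex ^ 'n \<Rightarrow> 'n::finite free_alg" where
  "fa_vec v = (\<Sum>i\<in>UNIV. fa_scale (v $ i) (fa_var i))"

definition homogeneous_of_degree :: "nat \<Rightarrow> 'x free_alg \<Rightarrow> bool" where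
  "homogeneous_of_degree d f \<longleftrightarrow> (\<forall>w\<in>Poly_Mapping.keys f. length (letters w) = d)"

definition commutator :: "'a::ring_1 \<Rightarrow> 'a \<Rightarrow> 'a" where
  "commutator a b = a * b - b * a"

fun left_normed_commutator :: "'a::ring_1 list \<Rightarrow> 'a" where
  "left_normed_commutator [] = 0"
| "left_normed_commutator (u # us) = foldl commutator u us"

definition two_sided_ideal :: "'a::ring_1 set \<Rightarrow> bool" where
  "two_sided_ideal J \<longleftrightarrow>
     0 \<in> J \<and> (\<forall>a\<in>J. \<forall>b\<in>J. a + b \<in> J) \<and> (\<forall>a\<in>J. \<forall>r. r * a \<in> J \<and> a * r \<in> J)"

definition generated_ideal :: "'a::ring_1 set \<Rightarrow> 'a set" where
  "generated_ideal S = \<Inter>{J. two_sided_ideal J \<and> S \<subseteq> J}"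

definition comm_ideal :: "nat \<Rightarrow> 'x free_alg set" where
  "comm_ideal m = generated_ideal {left_normed_commutator us | us. length us = m}"

definition SL_group :: "(complex ^ 'n ^ 'n::finite) set" where
  "SL_group = {g. det g = 1}"

definition symplectic_form :: "(complex ^ 'n \<Rightarrow> complex ^ 'n::finite \<Rightarrow> complex) \<Rightarrow> bool" where
  "symplectic_form \<omega> \<longleftrightarrow>
     (\<forall>u. Vector_Spaces.linear (*s) (*) (\<omega> u)) \<and>
     (\<forall>v. Vector_Spaces.linear (*s) (*) (\<lambda>u. \<omega> u v)) \<and>
     (\<forall>u v. \<omega> u v = - \<omega> v u) \<and>
     (\<forall>u. (\<forall>v. \<omega> u v = 0) \<longrightarrow> u = 0)"

definition Sp_group :: "(complex ^ 'n \<Rightarrow> complex ^ 'n::finite \<Rightarrow> complex) \<Rightarrow> (complex ^ 'n ^ 'n) set" where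
  "Sp_group \<omega> = {g. invertible g \<and> (\<forall>u v. \<omega> (g *v u) (g *v v) = \<omega> u v)}"

text \<open>The diagonal action sends the word \<open>x\<^sub>i\<dots>x\<^sub>j\<close> to the product \<open>(g x\<^sub>i)\<dots>(g x\<^sub>j)\<close>
  in the algebra and is extended linearly.\<close>

definition fa_act :: "complex ^ 'n ^ 'n \<Rightarrow> 'n::finite free_alg \<Rightarrow> 'n free_alg" where
  "fa_act g f = (\<Sum>w\<in>Poly_Mapping.keys f.
     fa_scale (Poly_Mapping.lookup f w)
       (prod_list (map (\<lambda>i. fa_vec (g *v axis i 1)) (letters w))))"

definition is_invariant :: "(complex ^ 'n ^ 'n) set \<Rightarrow> 'n::finite free_alg \<Rightarrow> bool" where
  "is_invariant G f \<longleftrightarrow> (\<forall>g\<in>G. fa_act g f = f)"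

end

theory Submission imports Defs begin

text \<open>Write \<open>I\<close> for \<open>I\<^sub>p\<^sub>+\<^sub>1\<close>. For a generator \<open>y\<close> put \<open>D = [y, -]\<close>. A word in which every letter \<open>y\<close> is
  replaced by \<open>D\<close> and every other letter by its left multiplication, applied to \<open>1\<close>, lies in \<open>I\<close> as
  soon as it contains \<open>p\<close> letters \<open>y\<close>; this rests on the inclusions \<open>[M\<^sub>j, R] \<subseteq> L\<^sub>j\<^sub>+\<^sub>1\<close> for odd \<open>j\<close> and
  \<open>M\<^sub>3 M\<^sub>j \<subseteq> M\<^sub>j\<^sub>+\<^sub>2\<close> of Bapat and Jordan for the lower central series. The operation on words is
  \<open>f \<mapsto> \<Sum>\<^sub>i (-1)\<^sup>i/i! (\<partial>\<^sub>y\<^sup>i f) y\<^sup>i\<close>, so an \<open>f\<close> of \<open>y\<close>-degree at least \<open>p\<close> with \<open>\<partial>\<^sub>y f \<in> I\<close> is itself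
  in \<open>I\<close>. If moreover \<open>f\<close> is killed by the derivation \<open>E\<close> that sends \<open>y\<close> to another generator \<open>x\<close> and
  the remaining generators to \<open>0\<close>, then \<open>[\<partial>\<^sub>x, E] = \<partial>\<^sub>y\<close> gives \<open>m \<partial>\<^sub>y \<partial>\<^sub>x\<^sup>m\<^sup>-\<^sup>1 f = - E \<partial>\<^sub>x\<^sup>m f\<close>, and
  descending induction on \<open>m\<close> puts every \<open>\<partial>\<^sub>x\<^sup>m f\<close>, in particular \<open>f\<close>, into \<open>I\<close>.

  An invariant of a group containing the transvections \<open>y \<mapsto> y + t x\<close> is killed by \<open>E\<close>, and so are its
  multihomogeneous components. If the degree exceeds \<open>n(p - 1)\<close>, each component has degree at least
  \<open>p\<close> in some generator \<open>y\<close>. Both groups contain a transvection for every \<open>y\<close>, the symplectic group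
  after passing to a symplectic basis, where \<open>x\<close> is the partner of \<open>y\<close>.\<close>

section \<open>The lower central series of a ring\<close>

inductive_set additive_span :: "'a::ab_group_add set \<Rightarrow> 'a set" for S where
  incl: "x \<in> S \<Longrightarrow> x \<in> additive_span S"
| zero: "0 \<in> additive_span S"
| add: "x \<in> additive_span S \<Longrightarrow> y \<in> additive_span S \<Longrightarrow> x + y \<in> additive_span S"
| uminus: "x \<in> additive_span S \<Longrightarrow> - x \<in> additive_span S"

text \<open>Subgroups instead of complex subspaces let this section work over an arbitrary ring;
  divisibility enters as an explicit inverse of 6 or of another numeral.\<close>

definition additive_subgroup :: "'a::ab_group_add set \<Rightarrow> bool" where
  "additive_subgroup A \<longleftrightarrow> 0 \<in> A \<and> (\<forall>x\<in>A. \<forall>y\<in>A. x + y \<in> A) \<and> (\<forall>x\<in>A. - x \<in> A)"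

lemma additive_subgroup_span: "additive_subgroup (additive_span S)"
  by (auto simp: additive_subgroup_def intro: additive_span.intros)

lemma additive_subgroupD:
  assumes "additive_subgroup A"
  shows "0 \<in> A" "x \<in> A \<Longrightarrow> y \<in> A \<Longrightarrow> x + y \<in> A" "x \<in> A \<Longrightarrow> - x \<in> A"
    "x \<in> A \<Longrightarrow> y \<in> A \<Longrightarrow> x - y \<in> A"
  using assms by (simp_all add: additive_subgroup_def diff_conv_add_uminus del: add_uminus_conv_diff)

lemma additive_span_image:
  assumes "x \<in> additive_span S" "Modules.additive \<phi>" "additive_subgroup A" "\<And>s. s \<in> S \<Longrightarrow> \<phi> s \<in> A"
  shows "\<phi> x \<in> A"
  using assms(1)
  by induction
    (use assms additive_subgroupD[OF assms(3)] in
      \<open>simp_all add: additive.add additive.zero additive.minus\<close>)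

lemma additive_subgroup_sum:
  assumes "additive_subgroup A" "\<And>i. i \<in> I \<Longrightarrow> f i \<in> A"
  shows "sum f I \<in> A"
  using assms(2)
  by (induction I rule: infinite_finite_induct) (simp_all add: additive_subgroupD[OF assms(1)])

section \<open>Commutator identities and the two filtrations\<close>

lemma commutator_anti: "commutator a c = - commutator c a"
  by (simp_all add: commutator_def algebra_simps)

lemma commutator_jacobi:
  "commutator a (commutator b c) = commutator (commutator a b) c - commutator (commutator a c) b"
  by (simp add: commutator_def algebra_simps)

lemma additive_commutator_left: "Modules.additive (\<lambda>a. commutator a b)"
  and additive_commutator_right: "Modules.additive (commutator b)"
  and additive_mult_left: "Modules.additive (\<lambda>a. a * (b::'a::ring_1))"
  and additive_mult_right: "Modules.additive (\<lambda>a. b * (a::'a::ring_1))"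
  by (simp_all add: Modules.additive_def commutator_def algebra_simps)

text \<open>In the usual indexing of the lower central series, \<open>lcs k\<close> is \<open>L\<^sub>k\<^sub>+\<^sub>1\<close> and
  \<open>lci k\<close> is \<open>M\<^sub>k\<^sub>+\<^sub>1 = R L\<^sub>k\<^sub>+\<^sub>1\<close>; with this shift the degrees of both filtrations add up.\<close>

fun lcs :: "nat \<Rightarrow> 'a::ring_1 set" where
  "lcs 0 = UNIV"
| "lcs (Suc k) = additive_span {commutator a b | a b. a \<in> lcs k}"

declare lcs.simps(2) [simp del]

definition lci :: "nat \<Rightarrow> 'a::ring_1 set" where
  "lci k = additive_span {w * l | w l. l \<in> lcs k}"

lemma additive_subgroup_lcs: "additive_subgroup (lcs k)"
  by (cases k) (simp_all add: additive_subgroup_span lcs.simps(2), simp add: additive_subgroup_def)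

lemma additive_subgroup_lci: "additive_subgroup (lci k)"
  by (simp add: lci_def additive_subgroup_span)

lemmas lcs_closed = additive_subgroupD[OF additive_subgroup_lcs]
lemmas lci_closed = additive_subgroupD[OF additive_subgroup_lci]

lemma commutator_lcs_left: "a \<in> lcs k \<Longrightarrow> commutator a b \<in> lcs (Suc k)"
  unfolding lcs.simps(2) by (rule additive_span.incl) blast

text \<open>Reduces membership claims about \<open>lcs (Suc k)\<close> to single brackets. The map
  \<open>\<phi>\<close> will be the identity, a bracket, a multiplication or a composite of
  these.\<close>

lemma lcs_Suc_image:
  assumes "x \<in> lcs (Suc k)" "Modules.additive \<phi>" "additive_subgroup A"
    "\<And>a b. a \<in> lcs k \<Longrightarrow> \<phi> (commutator a b) \<in> A"
  shows "\<phi> x \<in> A"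
  by (rule additive_span_image[OF _ assms(2,3)]) (use assms in \<open>auto simp: lcs.simps(2)\<close>)

lemma lci_image:
  assumes "x \<in> lci k" "Modules.additive \<phi>" "additive_subgroup A"
    "\<And>w l. l \<in> lcs k \<Longrightarrow> \<phi> (w * l) \<in> A"
  shows "\<phi> x \<in> A"
  by (rule additive_span_image[OF _ assms(2,3)]) (use assms in \<open>auto simp: lci_def\<close>)

lemma additive_id: "Modules.additive (\<lambda>x. x)"
  by (simp add: Modules.additive_def)

lemma lcs_Suc_subset: "lcs (Suc k) \<subseteq> (lcs k :: 'a::ring_1 set)"
proof (induction k)
  case (Suc k)
  show ?case
  proof
    fix x :: 'a assume x: "x \<in> lcs (Suc (Suc k))"
    show "x \<in> lcs (Suc k)"
      by (rule lcs_Suc_image[OF x additive_id additive_subgroup_lcs])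
        (use Suc commutator_lcs_left in blast)
  qed
qed simp

lemma lcs_antimono: "i \<le> k \<Longrightarrow> lcs k \<subseteq> (lcs i :: 'a::ring_1 set)"
  by (rule lift_Suc_antimono_le[of lcs]) (rule lcs_Suc_subset)

text \<open>The Jacobi identity gives \<open>[a, [u, v]] = [[a, u], v] - [[a, v], u]\<close>; both
  terms are covered by the induction on \<open>k\<close> because \<open>j\<close> is
  arbitrary.\<close>

lemma commutator_lcs_lcs:
  assumes "a \<in> lcs j" "b \<in> lcs k"
  shows "commutator a b \<in> lcs (j + k + 1)"
  using assms
proof (induction k arbitrary: a b j)
  case 0
  then show ?case using commutator_lcs_left by simp
next
  case (Suc k)
  show ?case
  proof (rule lcs_Suc_image[OF Suc.prems(2) additive_commutator_right additive_subgroup_lcs])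
    fix u v :: 'a assume u: "u \<in> lcs k"
    have "commutator (commutator a u) v \<in> lcs (j + Suc k + 1)"
      using commutator_lcs_left Suc.IH[OF Suc.prems(1) u] by simp
    moreover have "commutator (commutator a v) u \<in> lcs (j + Suc k + 1)"
      using Suc.IH[OF commutator_lcs_left[OF Suc.prems(1)] u] by simp
    ultimately show "commutator a (commutator u v) \<in> lcs (j + Suc k + 1)"
      unfolding commutator_jacobi by (rule lcs_closed(4))
  qed
qed

lemma lcs_subset_lci: "lcs k \<subseteq> lci k"
proof
  fix l :: 'a assume "l \<in> lcs k"
  then have "1 * l \<in> lci k"
    unfolding lci_def by (intro additive_span.incl) blast
  then show "l \<in> lci k" by simp
qed

lemma mult_lcs_lci: "l \<in> lcs k \<Longrightarrow> w * (l::'a::ring_1) \<in> lci k"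
  unfolding lci_def by (intro additive_span.incl) blast

lemma lci_mult_left: "x \<in> lci k \<Longrightarrow> a * x \<in> lci k"
  by (rule lci_image[OF _ additive_mult_right additive_subgroup_lci])
    (auto simp: mult.assoc[symmetric] intro: mult_lcs_lci)

text \<open>\<open>l a = a l + [l, a]\<close>, and the bracket stays in \<open>lcs k\<close>. This
  is what makes the left ideal \<open>lci k\<close> two-sided.\<close>

lemma lcs_mult_lci: "l \<in> lcs k \<Longrightarrow> l * a \<in> lci k"
proof -
  assume l: "l \<in> lcs k"
  have "l * a = a * l + 1 * commutator l a"
    by (simp add: commutator_def)
  moreover have "commutator l a \<in> lcs k"
    using l commutator_lcs_left lcs_Suc_subset by blast
  ultimately show ?thesis
    using l lci_closed(2) mult_lcs_lci by metis
qed

lemma lci_mult_right: "x \<in> lci k \<Longrightarrow> x * a \<in> lci k"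
  by (rule lci_image[OF _ additive_mult_left additive_subgroup_lci])
    (auto simp: mult.assoc intro: lci_mult_left lcs_mult_lci)

lemma lci_antimono: "i \<le> k \<Longrightarrow> x \<in> lci k \<Longrightarrow> x \<in> lci i"
  by (rule lci_image[OF _ additive_id additive_subgroup_lci])
    (use lcs_antimono mult_lcs_lci in \<open>blast+\<close>)

lemma lci_0: "lci 0 = UNIV"
  using lcs_subset_lci[of 0] by auto

section \<open>Brackets of the ideals \<open>lci j\<close> with ring elements\<close>

text \<open>The induction of \<open>commutator_lcs_lcs\<close> again; the premise \<open>O\<close>
  supplies the base case, to be established for even \<open>j\<close>.\<close>

lemma commutator_lci_lcs:
  fixes m l :: "'a::ring_1"
  assumes O: "\<And>m a::'a. m \<in> lci j \<Longrightarrow> commutator m a \<in> lcs (j + 1)"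
    and "m \<in> lci j" "l \<in> lcs k"
  shows "commutator m l \<in> lcs (j + k + 1)"
  using assms(2,3)
proof (induction k arbitrary: l)
  case 0
  then show ?case using O by simp
next
  case (Suc k)
  show ?case
  proof (rule lcs_Suc_image[OF Suc.prems(2) additive_commutator_right additive_subgroup_lcs])
    fix u v :: 'a assume u: "u \<in> lcs k"
    have "commutator (commutator m u) v \<in> lcs (j + Suc k + 1)"
      using commutator_lcs_left Suc.IH[OF Suc.prems(1) u] by simp
    moreover have "commutator (commutator m v) u \<in> lcs (j + Suc k + 1)"
      using commutator_lcs_lcs[OF O[OF Suc.prems(1)] u] by simp
    ultimately show "commutator m (commutator u v) \<in> lcs (j + Suc k + 1)"
      unfolding commutator_jacobi by (rule lcs_closed(4))
  qed
qed

text \<open>An inverse of a numeral is central, so multiplication by it can be pushed into the first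
  slot of a bracket and preserves \<open>lcs k\<close>.\<close>

lemma lcs_cancel_numeral:
  fixes c x :: "'a::ring_1"
  assumes c: "numeral n * c = (1::'a)" and x: "numeral n * x \<in> lcs k"
  shows "x \<in> lcs k"
proof -
  have num_commute: "numeral n * a = a * (numeral n::'a)" for a
    by (metis mult_of_nat_commute of_nat_numeral)
  have central: "c * a = a * c" for a
    by (metis c mult.assoc mult_1 mult_1_right num_commute)
  have "c * y \<in> lcs k" if "y \<in> lcs k" for y
    using that
  proof (induction k arbitrary: y)
    case (Suc k)
    show ?case
    proof (rule lcs_Suc_image[OF Suc.prems additive_mult_right additive_subgroup_lcs])
      fix u v :: 'a assume "u \<in> lcs k"
      then have "commutator (c * u) v \<in> lcs (Suc k)"
        using Suc.IH commutator_lcs_left by blast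
      moreover have "commutator (c * u) v = c * commutator u v"
        unfolding commutator_def by (metis central mult.assoc right_diff_distrib)
      ultimately show "c * commutator u v \<in> lcs (Suc k)"
        by simp
    qed
  qed simp
  from this[OF x] show ?thesis
    by (metis c central mult.assoc mult_1 )
qed

text \<open>Antisymmetry of \<open>[w t, c]\<close> in \<open>w\<close> and \<open>c\<close> modulo
  \<open>lcs (Suc n)\<close>: the two orders add up to brackets that start with
  \<open>t\<close>.\<close>

lemma commutator_mult_swap_outer:
  assumes "t \<in> lcs n"
  shows "commutator (w * t) c + commutator (c * t) w \<in> lcs (Suc n)"
proof -
  have "commutator (w * t) c + commutator (c * t) w
      = commutator t (c * w) - commutator (commutator t c) w"
    by (simp add: commutator_def algebra_simps)
  moreover have "commutator (commutator t c) w \<in> lcs (Suc n)"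
    using assms commutator_lcs_left lcs_Suc_subset by blast
  ultimately show ?thesis
    using assms commutator_lcs_left lcs_closed(4) by metis
qed

text \<open>Antisymmetry in the inner pair \<open>w\<close>, \<open>z\<close>: expanding
  \<open>[k, z w]\<close> by the Leibniz rule gives \<open>w [k, z] + z [k, w]\<close> up to the
  longer bracket \<open>[[k, z], w]\<close>.\<close>

lemma commutator_mult_swap_inner:
  assumes "k \<in> lcs n"
  shows "commutator (w * commutator k z) c + commutator (z * commutator k w) c \<in> lcs (Suc (Suc n))"
proof -
  have "commutator (w * commutator k z) c + commutator (z * commutator k w) c
      = commutator (commutator k (z * w)) c - commutator (commutator (commutator k z) w) c"
    by (simp add: commutator_def algebra_simps)
  moreover have "commutator (commutator (commutator k z) w) c \<in> lcs (Suc (Suc n))"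
    using assms commutator_lcs_left lcs_Suc_subset by blast
  ultimately show ?thesis
    using assms commutator_lcs_left lcs_closed(4) by metis
qed

text \<open>By the alternating law, up to sign \<open>q\<close> is a function of the pair of its first two
  arguments, and the Jacobi identity says that it sums to zero over the edges of each triangle in the
  complete graph on five vertices. The edge-triangle incidence matrix is invertible after inverting 6.\<close>

lemma alternating_jacobi_vanish:
  fixes q :: "'b \<Rightarrow> 'b \<Rightarrow> 'b \<Rightarrow> 'b \<Rightarrow> 'b \<Rightarrow> 'a::ring_1"
  assumes S: "additive_subgroup S"
    and a12: "\<And>x y z w c. q x y z w c = - q y x z w c"
    and a34: "\<And>x y z w c. q x y z w c + q x y w z c \<in> S"
    and a45: "\<And>x y z w c. q x y z w c + q x y z c w \<in> S"
    and jac: "\<And>x y z w c. q x y z w c + q y z x w c + q z x y w c = 0"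
  shows "6 * q x y z w c \<in> S"
proof -
  note S = additive_subgroupD[OF S]
  \<comment> \<open>\<open>a34\<close> and \<open>a45\<close> are the adjacent transpositions of the
    last three arguments; composing them gives the 3-cycle here and the outer transposition in
    \<open>swap\<close>.\<close>
  have cyc: "q x y z w c - q x y w c z \<in> S" for x y z w c
    using S(4)[OF a34[of x y z w c] a45[of x y w z c]] by simp
  have swap: "q x y z w c + q x y c w z \<in> S" for x y z w c
    using S(4)[OF S(2)[OF a34[of x y z w c] a34[of x y w c z]] a45[of x y w z c]] 
    by (simp add: algebra_simps)
  \<comment> \<open>In the graph picture \<open>U y x z w c\<close> is the star at \<open>y\<close>
    without the edge to \<open>x\<close>. Modulo \<open>S\<close>, three triangles at
    \<open>y\<close> minus the triangle on \<open>z, w, c\<close> count this star twice.\<close>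
  define U where "U = (\<lambda>y x z w c. q y z x w c + q y w x c z + q y c x z w)"
  have U2: "2 * U y x z w c \<in> S" for y x z w c
  proof -
    have 1: "q y z w c x - q y w z c x + q z w y c x = 0" for y z w c x
      using jac[of y z w c x] a12[of w y z c x] by (simp add: algebra_simps)
    have 2: "q y z x w c + q y w x c z + q z w c x y \<in> S" for y x z w c
    proof -
      have "q y z x w c + q y w x c z + q z w c x y
         = (q y z x w c - q y z w c x) + (q y w z c x + q y w x c z) - (q z w y c x - q z w c x y)
          + (q y z w c x - q y w z c x + q z w y c x)"
        by (simp add: algebra_simps)
      then show ?thesis
        using 1 cyc swap S by (metis add.right_neutral)
    qed
    have "2 * U y x z w c = (q y z x w c + q y w x c z + q z w c x y) + (q y w x c z + q y c x z w + q w c z x y)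
      + (q y c x z w + q y z x w c + q c z w x y) - (q z w c x y + q w c z x y + q c z w x y)"
      by (simp add: U_def algebra_simps mult_2)
    also have "\<dots> \<in> S"
      using 2[of y z x w c] 2[of y w x c z] 2[of y c x z w] jac[of z w c x y] S by (metis diff_zero)
    finally show ?thesis .
  qed
  have six: "6 * v = 2 * v + 2 * v + 2 * v" for v :: 'a
    by (simp flip: distrib_right)
  \<comment> \<open>The three triangles on the edge from \<open>x\<close> to \<open>y\<close>
    contain it three times; modulo \<open>S\<close> their other edges form the star at
    \<open>y\<close> minus the star at \<open>x\<close>.\<close>
  have "6 * q x y z w c = 2 * (q x y z w c + q y z x w c + q z x y w c)
     + 2 * (q x y w c z + q y w x c z + q w x y c z)
     + 2 * (q x y c z w + q y c x z w + q c x y z w)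
     + 2 * (q x y z w c - q x y w c z) + 2 * (q x y z w c - q x y c z w)
     - 2 * U y x z w c + 2 * U x y z w c
     - 2 * (q z x y w c + q x z y w c) - 2 * (q w x y c z + q x w y c z) - 2 * (q c x y z w + q x c y z w)"
    by (simp add: U_def six algebra_simps)
  also have "\<dots> = 2 * (q x y z w c - q x y w c z) + 2 * (q x y z w c - q x y c z w)
     - 2 * U y x z w c + 2 * U x y z w c"
    using jac[of x y z w c] jac[of x y w c z] jac[of x y c z w] a12[of z x] a12[of w x] a12[of c x] by simp
  also have "\<dots> \<in> S"
  proof -
    have "q x y z w c - q x y w c z \<in> S" "q x y z w c - q x y c z w \<in> S"
      using cyc[of x y z w c] S(3)[OF cyc[of x y c z w]] by simp_all
    from S(2)[OF S(2)[OF this(1,1)] S(2)[OF this(2,2)]] show ?thesis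
      using S(2)[OF S(4)[OF _ U2[of y x z w c]] U2[of x y z w c]] unfolding mult_2 by blast
  qed
  finally show ?thesis .
qed

text \<open>The case \<open>j = 2\<close>, on which the general even case relies. Elements of
  \<open>lci 2\<close> are sums of \<open>w [[x, y], z]\<close>, and bracketing these with
  \<open>a\<close> gives a function to which \<open>alternating_jacobi_vanish\<close> applies modulo
  \<open>lcs 3\<close>.\<close>

lemma commutator_lci_2:
  fixes m a :: "'a::ring_1"
  assumes six: "\<exists>c. 6 * c = (1::'a)" and m: "m \<in> lci 2"
  shows "commutator m a \<in> lcs 3"
proof (rule lci_image[OF m additive_commutator_left additive_subgroup_lcs])
  fix w l :: 'a assume l: "l \<in> lcs 2"
  let ?q = "\<lambda>x y z w a. commutator (w * commutator (commutator x y) z) (a::'a)"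
  have q: "6 * ?q x y z w a \<in> lcs 3" for x y z w a
  proof (rule alternating_jacobi_vanish[where q = ?q, OF additive_subgroup_lcs])
    show "?q x y z w c = - ?q y x z w c" for x y z w c
      by (simp add: commutator_def algebra_simps)
    show "?q x y z w c + ?q y z x w c + ?q z x y w c = 0" for x y z w c
      by (simp add: commutator_def algebra_simps)
    have xy: "commutator x y \<in> lcs 1" for x y :: 'a
      using commutator_lcs_left[of x 0 y] by simp
    show "?q x y z w c + ?q x y w z c \<in> lcs 3" for x y z w c
      using commutator_mult_swap_inner[OF xy] by (simp add: numeral_3_eq_3)
    show "?q x y z w c + ?q x y z c w \<in> lcs 3" for x y z w c
      using commutator_mult_swap_outer[OF commutator_lcs_left[OF xy]] by (simp add: numeral_3_eq_3)
  qed
  obtain c :: 'a where c: "6 * c = 1" using six by blast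
  have 1: "Modules.additive (\<lambda>l. commutator (w * l) a)"
    by (simp add: Modules.additive_def commutator_def algebra_simps)
  have 2: "Modules.additive (\<lambda>k. commutator (w * commutator k z) a)" for z
    by (simp add: Modules.additive_def commutator_def algebra_simps)
  have 3: "commutator (w * commutator k z) a \<in> lcs 3" if "k \<in> lcs (Suc 0)" for k z
    using lcs_Suc_image[OF that 2 additive_subgroup_lcs] lcs_cancel_numeral[OF c q] by blast
  show "commutator (w * l) a \<in> lcs 3"
    using lcs_Suc_image[OF l[unfolded numeral_2_eq_2] 1 additive_subgroup_lcs] 3 by blast
qed

text \<open>Induction in steps of two: an element of \<open>lci (j + 2)\<close> is a sum of
  \<open>w [[l, y], z]\<close> with \<open>l\<close> in \<open>lcs j\<close>.\<close>

lemma commutator_lci_even: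
  fixes m a :: "'a::ring_1"
  assumes six: "\<exists>c. 6 * c = (1::'a)" and "even j" and m: "m \<in> lci j"
  shows "commutator m a \<in> lcs (j + 1)"
proof -
  have "\<forall>m\<in>lci (2 * i). \<forall>a::'a. commutator m a \<in> lcs (2 * i + 1)" for i
  proof (induction i)
    case 0
    show ?case using commutator_lcs_left[of _ 0] by auto
  next
    case (Suc i)
    define j where "j = 2 * i"
    have O: "\<And>m a::'a. m \<in> lci j \<Longrightarrow> commutator m a \<in> lcs (j + 1)"
      using Suc by (simp add: j_def)
    have O2: "\<And>m a::'a. m \<in> lci 2 \<Longrightarrow> commutator m a \<in> lcs (2 + 1)"
      using commutator_lci_2[OF six] by simp
    obtain h :: 'a where h: "2 * h = 1"
    proof -
      obtain c :: 'a where "6 * c = 1" using six by blast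
      then have "2 * (3 * c) = 1" by (simp flip: mult.assoc)
      then show thesis using that by blast
    qed
    txt \<open>Modulo \<open>lcs (j + 3)\<close> the expression is alternating in \<open>z, w, a\<close> but symmetric in
      \<open>y, z\<close>, so twice it vanishes.\<close>
    have key: "commutator (w * commutator (commutator l y) z) a \<in> lcs (j + 3)"
      if l: "l \<in> lcs j" for w l y z a :: 'a
    proof -
      let ?S = "lcs (j + 3) :: 'a set"
      let ?q = "\<lambda>y z w c. commutator (w * commutator (commutator l y) z) c"
      have ly: "commutator l y \<in> lcs (Suc j)" for y
        using l commutator_lcs_left by blast
      have zw: "?q y z w c + ?q y w z c \<in> ?S" for y z w c
        using commutator_mult_swap_inner[OF ly] by (simp add: numeral_3_eq_3)
      \<comment> \<open>Let \<open>v = [y, z]\<close> and \<open>t = [w, v]\<close>. By Jacobi the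
        difference is \<open>[w [l, v], c]\<close>, where \<open>w [l, v] = [w l, v] - t l\<close>.
        The cyclic identity \<open>[t l, c] + [l c, t] + [c t, l] = 0\<close> then leaves terms to
        which \<open>O\<close> and \<open>O2\<close> apply.\<close>
      have yz: "?q y z w c - ?q z y w c \<in> ?S" for y z w c
      proof -
        let ?v = "commutator y z" and ?t = "commutator w (commutator y z)"
        have v: "?v \<in> lcs 1"
          using commutator_lcs_left[of y 0 z] by simp
        have t: "?t \<in> lcs 2"
          using commutator_lcs_lcs[OF _ v, of w 0] by (simp add: numeral_2_eq_2)
        have "w * l \<in> lci j" "l * c \<in> lci j" "c * ?t \<in> lci 2"
          using l t by (auto intro: mult_lcs_lci lcs_mult_lci)
        then have "commutator (w * l) ?v \<in> lcs (j + 2)" "commutator (l * c) ?t \<in> ?S"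
          "commutator (c * ?t) l \<in> ?S"
          using commutator_lci_lcs[OF O _ v] commutator_lci_lcs[OF O _ t] commutator_lci_lcs[OF O2 _ l]
          by (simp_all add: add.commute[of 3] numeral_3_eq_3 numeral_2_eq_2)
        moreover have "?q y z w c - ?q z y w c = commutator (commutator (w * l) ?v) c
            + commutator (l * c) ?t + commutator (c * ?t) l"
          by (simp add: commutator_def algebra_simps)
        ultimately show ?thesis
          using commutator_lcs_left[of _ "j + 2" c]
          by (auto simp: numeral_3_eq_3 numeral_2_eq_2 intro!: lcs_closed(2))
      qed
      \<comment> \<open>A closed walk through the six orders of \<open>y, z, w\<close>. Each of the
        three swaps of type \<open>zw\<close> changes the sign, so \<open>?q\<close> returns as its
        negative.\<close>
      have "2 * ?q y z w a = (?q y z w a - ?q z y w a) + (?q z y w a + ?q z w y a)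
          - (?q z w y a - ?q w z y a) - (?q w z y a + ?q w y z a) + (?q w y z a - ?q y w z a)
          + (?q y z w a + ?q y w z a)"
        by (simp add: algebra_simps mult_2)
      also have "\<dots> \<in> ?S"
        by (intro lcs_closed zw yz)
      finally show ?thesis
        using lcs_cancel_numeral[OF h] by blast
    qed
    have 1: "Modules.additive (\<lambda>l. commutator (w * l) a)" for w a :: 'a
      by (simp add: Modules.additive_def commutator_def algebra_simps)
    have 2: "Modules.additive (\<lambda>k. commutator (w * commutator k z) a)" for w z a :: 'a
      by (simp add: Modules.additive_def commutator_def algebra_simps)
    have 3: "commutator (w * commutator k z) a \<in> lcs (j + 3)" if "k \<in> lcs (Suc j)" for w k z a :: 'a
      using lcs_Suc_image[OF that 2 additive_subgroup_lcs] key by blast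
    have 4: "commutator (w * k) a \<in> lcs (j + 3)" if "k \<in> lcs (Suc (Suc j))" for w k a :: 'a
      using lcs_Suc_image[OF that 1 additive_subgroup_lcs] 3 by blast
    have "commutator m a \<in> lcs (j + 3)" if "m \<in> lci (Suc (Suc j))" for m a :: 'a
      using lci_image[OF that additive_commutator_left additive_subgroup_lcs] 4 by blast
    then show ?case by (simp add: j_def numeral_3_eq_3)
  qed
  then show ?thesis using assms by (metis evenE)
qed

text \<open>\<open>m w [a, b] = [m w, a] b - [m w b, a]\<close> trades the product for brackets of
  \<open>lci 2\<close> with \<open>lcs i\<close>, which land in \<open>lcs (i + 3)\<close>.\<close>

lemma lci_2_mult:
  fixes m x :: "'a::ring_1"
  assumes six: "\<exists>c. 6 * c = (1::'a)" and m: "m \<in> lci 2" and x: "x \<in> lci k"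
  shows "m * x \<in> lci (k + 2)"
proof (rule lci_image[OF x additive_mult_right additive_subgroup_lci])
  have O2: "\<And>m a::'a. m \<in> lci 2 \<Longrightarrow> commutator m a \<in> lcs (2 + 1)"
    using commutator_lci_2[OF six] by simp
  fix w l :: 'a assume l: "l \<in> lcs k"
  have mw: "m * w \<in> lci 2"
    using m lci_mult_right by blast
  show "m * (w * l) \<in> lci (k + 2)"
  proof (cases k)
    case 0
    then show ?thesis using lci_mult_right[OF m] by (simp add: numeral_2_eq_2)
  next
    case (Suc i)
    have "(m * w) * l \<in> lci (k + 2)"
    proof (rule lcs_Suc_image[OF _ additive_mult_right additive_subgroup_lci])
      show "l \<in> lcs (Suc i)" using l Suc by simp
      fix a b :: 'a assume a: "a \<in> lcs i"
      have *: "commutator (m * w * b) a \<in> lcs (k + 2)" "commutator (m * w) a \<in> lcs (k + 2)"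
        using commutator_lci_lcs[OF O2 _ a] mw lci_mult_right[OF mw, of b] Suc by simp_all
      have "m * w * commutator a b = commutator (m * w) a * b - commutator (m * w * b) a"
        by (simp add: commutator_def algebra_simps)
      then show "m * w * commutator a b \<in> lci (k + 2)"
        using * lcs_subset_lci lcs_mult_lci lci_closed(4) by (metis subsetD)
    qed
    then show ?thesis by (simp add: mult.assoc)
  qed
qed

section \<open>Iterated brackets with a fixed element\<close>

text \<open>Odd steps need a filtration finer than \<open>lci\<close>: applying \<open>commutator y\<close> to a general element of
  \<open>lci k\<close> with \<open>k\<close> odd need not land in \<open>lci (k + 1)\<close>.\<close>

definition ad_filtration :: "'a::ring_1 \<Rightarrow> nat \<Rightarrow> 'a set" where
  "ad_filtration y k = (if even k then lci k
     else additive_span {z * commutator y a | z a. a \<in> lci (k - 1)})"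

text \<open>For odd \<open>k\<close> the index \<open>k - 1\<close> is even, so
  \<open>commutator_lci_even\<close> applies to the generators.\<close>

lemma ad_filtration_subset_lci:
  assumes six: "\<exists>c. 6 * c = (1::'a::ring_1)" and x: "x \<in> ad_filtration (y::'a) k"
  shows "x \<in> lci k"
proof (cases "even k")
  case False
  have "commutator y a \<in> lcs k" if "a \<in> lci (k - 1)" for a
    using commutator_lci_even[OF six _ that, of y] lcs_closed(3) commutator_anti[of y a] False
    by simp
  moreover have "x \<in> additive_span {z * commutator y a | z a. a \<in> lci (k - 1)}"
    using x False by (simp add: ad_filtration_def)
  ultimately show ?thesis
    using additive_span_image[OF _ additive_id additive_subgroup_lci] mult_lcs_lci by blast
qed (use x in \<open>simp add: ad_filtration_def\<close>)

lemma ad_filtration_mult_left: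
  assumes "x \<in> ad_filtration (y::'a::ring_1) k"
  shows "z * x \<in> ad_filtration y k"
proof (cases "even k")
  case False
  then have x: "x \<in> additive_span {z * commutator y a | z a. a \<in> lci (k - 1)}"
    using assms by (simp add: ad_filtration_def)
  have "z * s \<in> {z * commutator y a | z a. a \<in> lci (k - 1)}"
    if "s \<in> {z * commutator y a | z a. a \<in> lci (k - 1)}" for s
    using that by clarify (metis mult.assoc)
  then have "z * x \<in> additive_span {z * commutator y a | z a. a \<in> lci (k - 1)}"
    using additive_span_image[OF x additive_mult_right additive_subgroup_span]
    by (blast intro: additive_span.incl)
  then show ?thesis
    using False by (simp add: ad_filtration_def)
qed (use assms lci_mult_left in \<open>simp add: ad_filtration_def\<close>)

text \<open>For \<open>D = [y, -]\<close> the Leibniz rule gives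
  \<open>D D (z a) = (D D z) a + 2 (D z) (D a) + z (D D a)\<close>. All terms with
  \<open>D D\<close> lie in \<open>lci (k + 2)\<close>, the term \<open>(D D z) a\<close> by
  \<open>lci_2_mult\<close>; as 2 is invertible, so does \<open>(D z) (D a)\<close>.\<close>

lemma commutator_mult_commutator_lci:
  fixes y z a :: "'a::ring_1"
  assumes six: "\<exists>c. 6 * c = (1::'a)" and "even k" and a: "a \<in> lci k"
  shows "commutator y (z * commutator y a) \<in> lci (k + 2)"
proof -
  let ?D = "commutator y"
  have DD: "?D (?D b) \<in> lci (j + 2)" if "even j" "b \<in> lci j" for b j
  proof -
    have "commutator (commutator b y) y \<in> lcs (j + 2)"
      using commutator_lcs_left[OF commutator_lci_even[OF six that, of y], of y] by simp
    moreover have "?D (?D b) = commutator (commutator b y) y"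
      by (simp add: commutator_def algebra_simps)
    ultimately show ?thesis
      using lcs_subset_lci by auto
  qed
  obtain c :: 'a where c: "6 * c = 1" using six by blast
  have half: "3 * c * (2 * x) = x" for x
  proof -
    have "3 * c * (2 * x) = 6 * c * x"
      by (metis (no_types, opaque_lifting) mult.assoc mult_2 mult_2_right numeral_Bit0 distrib_left distrib_right)
    then show ?thesis using c by simp
  qed
  have zDDa: "z * ?D (?D a) \<in> lci (k + 2)"
    using DD[OF \<open>even k\<close> a] lci_mult_left by blast
  have "?D (?D z) * a \<in> lci (k + 2)"
    using lci_2_mult[OF six _ a] DD[of 0 z] by (simp add: lci_0 numeral_2_eq_2)
  moreover have "2 * (?D z * ?D a) = ?D (?D (z * a)) - ?D (?D z) * a - z * ?D (?D a)"
    by (simp add: commutator_def algebra_simps mult_2)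
  ultimately have "2 * (?D z * ?D a) \<in> lci (k + 2)"
    using DD[OF \<open>even k\<close> lci_mult_left[OF a]] zDDa lci_closed(4) by metis
  then have "?D z * ?D a \<in> lci (k + 2)"
    using lci_mult_left half by metis
  moreover have "?D (z * ?D a) = ?D z * ?D a + z * ?D (?D a)"
    by (simp add: commutator_def algebra_simps)
  ultimately show ?thesis
    using zDDa lci_closed(2) by metis
qed

lemma ad_filtration_commutator:
  assumes six: "\<exists>c. 6 * c = (1::'a::ring_1)" and x: "x \<in> ad_filtration (y::'a) k"
  shows "commutator y x \<in> ad_filtration y (Suc k)"
proof (cases "even k")
  case True
  then have "1 * commutator y x \<in> additive_span {z * commutator y a | z a. a \<in> lci k}"
    using x unfolding ad_filtration_def by (intro additive_span.incl CollectI exI conjI) (rule refl, simp)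
  then show ?thesis
    using True by (simp add: ad_filtration_def)
next
  case False
  then have "x \<in> additive_span {z * commutator y a | z a. a \<in> lci (k - 1)}"
    using x by (simp add: ad_filtration_def)
  moreover have "commutator y (z * commutator y a) \<in> lci (Suc k)" if "a \<in> lci (k - 1)" for z a
    using commutator_mult_commutator_lci[OF six _ that] False by (simp add: odd_pos)
  ultimately have "commutator y x \<in> lci (Suc k)"
    using additive_span_image[OF _ additive_commutator_right additive_subgroup_lci] by blast
  then show ?thesis
    using False by (simp add: ad_filtration_def)
qed

section \<open>Derivations, homomorphisms and comparison with the commutator ideal\<close>

lemma derivation_lci:
  fixes \<delta> :: "'a::ring_1 \<Rightarrow> 'a"
  assumes add: "Modules.additive \<delta>" and leibniz: "\<And>a b. \<delta> (a * b) = \<delta> a * b + a * \<delta> b"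
    and x: "x \<in> lci k"
  shows "\<delta> x \<in> lci k"
proof (rule lci_image[OF x add additive_subgroup_lci])
  have lcs: "\<delta> l \<in> lcs k" if "l \<in> lcs k" for k l
    using that
  proof (induction k arbitrary: l)
    case (Suc k)
    show ?case
    proof (rule lcs_Suc_image[OF Suc.prems add additive_subgroup_lcs])
      fix a b :: 'a assume "a \<in> lcs k"
      moreover have "\<delta> (commutator a b) = commutator (\<delta> a) b + commutator a (\<delta> b)"
        by (simp add: commutator_def leibniz additive.diff[OF add])
      ultimately show "\<delta> (commutator a b) \<in> lcs (Suc k)"
        using Suc.IH commutator_lcs_left lcs_closed(2) by metis
    qed
  qed simp
  show "\<delta> (w * l) \<in> lci k" if "l \<in> lcs k" for w l
    unfolding leibniz using that lcs mult_lcs_lci lci_closed(2) by blast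
qed

lemma ring_hom_lci:
  fixes \<phi> :: "'a::ring_1 \<Rightarrow> 'b::ring_1"
  assumes add: "Modules.additive \<phi>" and mult: "\<And>a b. \<phi> (a * b) = \<phi> a * \<phi> b"
    and x: "x \<in> lci k"
  shows "\<phi> x \<in> lci k"
proof (rule lci_image[OF x add additive_subgroup_lci])
  have lcs: "\<phi> l \<in> lcs k" if "l \<in> lcs k" for k l
    using that
  proof (induction k arbitrary: l)
    case (Suc k)
    show ?case
    proof (rule lcs_Suc_image[OF Suc.prems add additive_subgroup_lcs])
      fix a b :: 'a assume "a \<in> lcs k"
      moreover have "\<phi> (commutator a b) = commutator (\<phi> a) (\<phi> b)"
        by (simp add: commutator_def mult additive.diff[OF add])
      ultimately show "\<phi> (commutator a b) \<in> lcs (Suc k)"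
        using Suc.IH commutator_lcs_left by metis
    qed
  qed simp
  show "\<phi> (w * l) \<in> lci k" if "l \<in> lcs k" for w l
    unfolding mult using that lcs mult_lcs_lci by blast
qed

lemma lcs_subset_left_normed:
  "lcs k \<subseteq> additive_span {left_normed_commutator us | us. length us = Suc k}"
proof (induction k)
  case 0
  have "x = left_normed_commutator [x]" for x :: 'a by simp
  then have "x \<in> {left_normed_commutator us | us. length us = Suc 0}" for x :: 'a
    by (metis (mono_tags, lifting) length_Cons list.size(3) mem_Collect_eq)
  then show ?case by (blast intro: additive_span.incl)
next
  case (Suc k)
  let ?S = "\<lambda>k. additive_span {left_normed_commutator us :: 'a | us. length us = Suc k}"
  show ?case
  proof
    fix x :: 'a assume x: "x \<in> lcs (Suc k)"
    show "x \<in> ?S (Suc k)"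
    proof (rule lcs_Suc_image[OF x additive_id additive_subgroup_span])
      fix a b :: 'a assume "a \<in> lcs k"
      then have a: "a \<in> ?S k" using Suc by blast
      show "commutator a b \<in> ?S (Suc k)"
      proof (rule additive_span_image[OF a additive_commutator_left additive_subgroup_span])
        fix s assume "s \<in> {left_normed_commutator us :: 'a | us. length us = Suc k}"
        then obtain u us where "s = foldl commutator u us" "length us = k"
          by (auto simp: length_Suc_conv)
        then have "commutator s b = left_normed_commutator (u # us @ [b])" "length (u # us @ [b]) = Suc (Suc k)"
          by simp_all
        then show "commutator s b \<in> ?S (Suc k)"
          by (intro additive_span.incl) blast
      qed
    qed
  qed
qed

text \<open>Links the recursive filtration to the ideal of the theorem: \<open>lci p\<close>
  corresponds to commutators of length \<open>p + 1\<close>.\<close>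

lemma lci_subset_generated_ideal:
  "lci k \<subseteq> generated_ideal {left_normed_commutator us | us. length us = Suc k}"
proof
  fix x :: 'a assume x: "x \<in> lci k"
  show "x \<in> generated_ideal {left_normed_commutator us | us. length us = Suc k}"
    unfolding generated_ideal_def
  proof (rule InterI, clarify)
    fix J :: "'a set"
    assume J: "two_sided_ideal J" "{left_normed_commutator us | us. length us = Suc k} \<subseteq> J"
    \<comment> \<open>Negatives come from multiplying by -1.\<close>
    have "- a \<in> J" if "a \<in> J" for a
      using J(1) that mult_minus1 unfolding two_sided_ideal_def by metis
    then have sub: "additive_subgroup J"
      using J(1) by (simp add: two_sided_ideal_def additive_subgroup_def)
    show "x \<in> J"
    proof (rule lci_image[OF x additive_id sub])
      fix w l :: 'a assume "l \<in> lcs k"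
      then have "l \<in> additive_span {left_normed_commutator us | us. length us = Suc k}"
        using lcs_subset_left_normed by blast
      then have "l \<in> J"
        by (rule additive_span_image[OF _ additive_id sub]) (use J(2) in blast)
      then show "w * l \<in> J"
        using J(1) by (simp add: two_sided_ideal_def)
    qed
  qed
qed

section \<open>Derivations of the free algebra\<close>

definition fa_word :: "'x list \<Rightarrow> 'x free_alg" where
  "fa_word w = Poly_Mapping.single (FM w) 1"

definition fa_extend :: "('x list \<Rightarrow> 'y free_alg) \<Rightarrow> 'x free_alg \<Rightarrow> 'y free_alg" where
  "fa_extend \<phi> f = (\<Sum>w\<in>Poly_Mapping.keys f. fa_scale (Poly_Mapping.lookup f w) (\<phi> (letters w)))"

definition fa_linear :: "('x free_alg \<Rightarrow> 'y free_alg) \<Rightarrow> bool" where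
  "fa_linear \<phi> \<longleftrightarrow> (\<forall>f g. \<phi> (f + g) = \<phi> f + \<phi> g) \<and> (\<forall>c f. \<phi> (fa_scale c f) = fa_scale c (\<phi> f))"

lemma poly_mapping_sum_single:
  "f = (\<Sum>k\<in>Poly_Mapping.keys f. Poly_Mapping.single k (Poly_Mapping.lookup f k))"
  by (rule poly_mapping_eqI) (simp add: lookup_sum lookup_single when_def in_keys_iff)

lemma single_0_commute: "Poly_Mapping.single 0 c * f = f * Poly_Mapping.single 0 (c::complex)"
  for f :: "'x free_alg"
  by (subst (1 2) poly_mapping_sum_single)
    (simp add: sum_distrib_left sum_distrib_right mult_single mult.commute)

lemma fa_scale_add_right: "fa_scale c (f + g) = fa_scale c f + fa_scale c g"
  and fa_scale_add_left: "fa_scale (a + b) f = fa_scale a f + fa_scale b f"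
  and fa_scale_scale: "fa_scale a (fa_scale b f) = fa_scale (a * b) f"
  and fa_scale_one [simp]: "fa_scale 1 f = f"
  and fa_scale_zero_left [simp]: "fa_scale 0 f = 0"
  and fa_scale_zero_right [simp]: "fa_scale c 0 = 0"
  and fa_scale_mult_left: "fa_scale c f * g = fa_scale c (f * g)"
  and fa_scale_minus_left: "fa_scale (- a) f = - fa_scale a f"
  by (simp_all add: fa_scale_def distrib_left distrib_right single_add mult_single single_uminus
      flip: mult.assoc)

lemma fa_scale_mult_right: "f * fa_scale c g = fa_scale c (f * g)"
  unfolding fa_scale_def by (metis mult.assoc single_0_commute)

lemma fa_scale_of_nat_Suc: "fa_scale (of_nat (Suc n)) f = fa_scale (of_nat n) f + f"
  by (simp add: fa_scale_add_left add.commute)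

lemma lookup_fa_scale: "Poly_Mapping.lookup (fa_scale c f) w = c * Poly_Mapping.lookup f w"
  unfolding fa_scale_def mult_map_scale_conv_mult[symmetric]
  by (simp add: Poly_Mapping.map.rep_eq when_def)

lemma fa_scale_sum: "fa_scale c (sum f I) = (\<Sum>i\<in>I. fa_scale c (f i))"
  by (simp add: fa_scale_def sum_distrib_left)

lemma fa_expand:
  "f = (\<Sum>w\<in>Poly_Mapping.keys f. fa_scale (Poly_Mapping.lookup f w) (fa_word (letters w)))"
  by (rule poly_mapping_eqI)
    (simp add: lookup_sum lookup_fa_scale fa_word_def lookup_single when_def in_keys_iff
      if_distrib[of "\<lambda>x. _ * x"] cong: if_cong)

lemma fa_word_Nil: "fa_word [] = 1"
  and fa_word_append: "fa_word (u @ v) = fa_word u * fa_word v"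
  and fa_word_Cons: "fa_word (i # v) = fa_var i * fa_word v"
  and fa_word_single: "fa_word [i] = fa_var i"
  by (simp_all add: fa_word_def fa_var_def mult_single plus_free_monoid_def flip: zero_free_monoid_def)

lemma keys_fa_word [simp]: "Poly_Mapping.keys (fa_word w) = {FM w}"
  and lookup_fa_word [simp]: "Poly_Mapping.lookup (fa_word w) v = (if v = FM w then 1 else 0)"
  by (auto simp: fa_word_def lookup_single when_def)

lemma fa_linearD:
  assumes "fa_linear \<phi>"
  shows "\<phi> (f + g) = \<phi> f + \<phi> g" "\<phi> (fa_scale c f) = fa_scale c (\<phi> f)" "Modules.additive \<phi>"
  using assms by (auto simp: fa_linear_def Modules.additive_def)

lemma fa_linear_zero: "fa_linear \<phi> \<Longrightarrow> \<phi> 0 = 0"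
  and fa_linear_diff: "fa_linear \<phi> \<Longrightarrow> \<phi> (f - g) = \<phi> f - \<phi> g"
  and fa_linear_minus: "fa_linear \<phi> \<Longrightarrow> \<phi> (- f) = - \<phi> f"
  and fa_linear_sum: "fa_linear \<phi> \<Longrightarrow> \<phi> (sum h I) = (\<Sum>i\<in>I. \<phi> (h i))"
  using fa_linearD(3) additive.zero additive.diff additive.minus additive.sum by blast+

lemma fa_linear_expand:
  assumes "fa_linear \<phi>"
  shows "\<phi> f = (\<Sum>w\<in>Poly_Mapping.keys f. fa_scale (Poly_Mapping.lookup f w) (\<phi> (fa_word (letters w))))"
  by (subst (1) fa_expand) (simp add: fa_linear_sum[OF assms] fa_linearD(2)[OF assms])

lemma fa_linear_eqI:
  assumes "fa_linear \<phi>" "fa_linear \<psi>" "\<And>w. \<phi> (fa_word w) = \<psi> (fa_word w)"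
  shows "\<phi> f = \<psi> f"
  unfolding fa_linear_expand[OF assms(1), of f] fa_linear_expand[OF assms(2), of f]
  by (simp add: assms(3))

lemma fa_linear_intros:
  "fa_linear (\<lambda>f. f)"
  "fa_linear (\<lambda>f. 0)"
  "fa_linear \<phi> \<Longrightarrow> fa_linear (\<lambda>f. fa_scale c (\<phi> f))"
  "fa_linear \<phi> \<Longrightarrow> fa_linear (\<lambda>f. h * \<phi> f)"
  "fa_linear \<phi> \<Longrightarrow> fa_linear (\<lambda>f. \<phi> f * h)"
  "fa_linear \<phi> \<Longrightarrow> fa_linear \<psi> \<Longrightarrow> fa_linear (\<lambda>f. \<phi> f + \<psi> f)"
  "fa_linear \<phi> \<Longrightarrow> fa_linear \<psi> \<Longrightarrow> fa_linear (\<lambda>f. \<phi> f - \<psi> f)"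
  by (simp_all add: fa_linear_def distrib_left distrib_right fa_scale_add_right fa_scale_scale
      fa_scale_mult_left fa_scale_mult_right mult.commute)
    (simp add: fa_scale_def right_diff_distrib)

lemma fa_linear_comp: "fa_linear \<phi> \<Longrightarrow> fa_linear \<psi> \<Longrightarrow> fa_linear (\<lambda>f. \<phi> (\<psi> f))"
  by (simp add: fa_linear_def)

lemma fa_linear_sum_fun: "(\<And>i. i \<in> I \<Longrightarrow> fa_linear (\<phi> i)) \<Longrightarrow> fa_linear (\<lambda>f. \<Sum>i\<in>I. \<phi> i f)"
  by (induction I rule: infinite_finite_induct) (simp_all add: fa_linear_intros)

lemma fa_linear_funpow: "fa_linear \<phi> \<Longrightarrow> fa_linear (\<phi> ^^ n)"
  for \<phi> :: "'x free_alg \<Rightarrow> 'x free_alg"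
  by (induction n) (simp_all add: fa_linear_def)

lemma lci_fa_scale: "f \<in> lci k \<Longrightarrow> fa_scale c f \<in> lci k"
  by (simp add: fa_scale_def lci_mult_left)

lemma fa_linear_in_lci:
  assumes "fa_linear \<phi>" "\<And>w. w \<in> Poly_Mapping.keys f \<Longrightarrow> \<phi> (fa_word (letters w)) \<in> lci k"
  shows "\<phi> f \<in> lci k"
  unfolding fa_linear_expand[OF assms(1), of f]
  by (intro additive_subgroup_sum additive_subgroup_lci lci_fa_scale assms(2))

lemma fa_extend_superset:
  assumes "finite A" "Poly_Mapping.keys f \<subseteq> A"
  shows "fa_extend \<phi> f = (\<Sum>w\<in>A. fa_scale (Poly_Mapping.lookup f w) (\<phi> (letters w)))"
  unfolding fa_extend_def
  by (rule sum.mono_neutral_left) (use assms in \<open>auto simp: in_keys_iff\<close>)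

lemma fa_linear_extend: "fa_linear (fa_extend \<phi>)"
  unfolding fa_linear_def
proof (intro conjI allI)
  fix f g :: "'a free_alg" and c :: complex
  let ?A = "Poly_Mapping.keys f \<union> Poly_Mapping.keys g"
  show "fa_extend \<phi> (f + g) = fa_extend \<phi> f + fa_extend \<phi> g"
    by (simp add: fa_extend_superset[of ?A] Poly_Mapping.keys_add lookup_add fa_scale_add_left sum.distrib)
  have "Poly_Mapping.keys (fa_scale c f) \<subseteq> Poly_Mapping.keys f"
    by (auto simp: in_keys_iff lookup_fa_scale)
  then show "fa_extend \<phi> (fa_scale c f) = fa_scale c (fa_extend \<phi> f)"
    by (simp add: fa_extend_superset[of "Poly_Mapping.keys f"] lookup_fa_scale fa_scale_sum fa_scale_scale)
qed

lemma fa_extend_word [simp]: "fa_extend \<phi> (fa_word w) = \<phi> w"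
  by (simp add: fa_extend_def)

lemma fa_bilinear_eqI:
  assumes "\<And>g. fa_linear (\<lambda>f. B f g)" "\<And>f. fa_linear (B f)"
    "\<And>g. fa_linear (\<lambda>f. C f g)" "\<And>f. fa_linear (C f)"
    "\<And>u v. B (fa_word u) (fa_word v) = C (fa_word u) (fa_word v)"
  shows "B f g = C f g"
proof -
  have "B (fa_word u) g = C (fa_word u) g" for u
    by (rule fa_linear_eqI[OF assms(2,4)]) (rule assms(5))
  then show ?thesis
    by (rule fa_linear_eqI[OF assms(1,3)])
qed

fun fa_der_word :: "('x \<Rightarrow> 'x free_alg) \<Rightarrow> 'x list \<Rightarrow> 'x free_alg" where
  "fa_der_word a [] = 0"
| "fa_der_word a (i # w) = a i * fa_word w + fa_var i * fa_der_word a w"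

definition fa_der :: "('x \<Rightarrow> 'x free_alg) \<Rightarrow> 'x free_alg \<Rightarrow> 'x free_alg" where
  "fa_der a = fa_extend (fa_der_word a)"

lemma fa_linear_der: "fa_linear (fa_der a)"
  by (simp add: fa_der_def fa_linear_extend)

lemma fa_der_mult: "fa_der a (f * g) = fa_der a f * g + f * fa_der a g"
proof (rule fa_bilinear_eqI[where B = "\<lambda>f g. fa_der a (f * g)"
      and C = "\<lambda>f g. fa_der a f * g + f * fa_der a g"])
  fix u v
  show "fa_der a (fa_word u * fa_word v) = fa_der a (fa_word u) * fa_word v + fa_word u * fa_der a (fa_word v)"
    unfolding fa_word_append[symmetric] fa_der_def fa_extend_word
    by (induction u) (simp_all add: fa_word_Nil fa_word_append fa_word_Cons algebra_simps)
qed (intro fa_linear_intros fa_linear_comp[OF fa_linear_der] fa_linear_der)+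

lemma fa_der_1 [simp]: "fa_der a 1 = 0"
  unfolding fa_word_Nil[symmetric] fa_der_def fa_extend_word by simp

lemma fa_der_var: "fa_der a (fa_var i) = a i"
  unfolding fa_word_single[symmetric] fa_der_def fa_extend_word by (simp add: fa_word_Nil)

lemma fa_der_lci: "f \<in> lci k \<Longrightarrow> fa_der a f \<in> lci k"
  by (rule derivation_lci[OF fa_linearD(3)[OF fa_linear_der] fa_der_mult])

text \<open>The bracket of two derivations is again a derivation, hence determined by its values on
  generators.\<close>

lemma fa_der_commute:
  assumes "\<And>i. fa_der a (b i) - fa_der b (a i) = c i"
  shows "fa_der a (fa_der b f) - fa_der b (fa_der a f) = fa_der c f"
proof (rule fa_linear_eqI[where \<phi> = "\<lambda>f. fa_der a (fa_der b f) - fa_der b (fa_der a f)"])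
  show "fa_linear (\<lambda>f. fa_der a (fa_der b f) - fa_der b (fa_der a f))"
    by (intro fa_linear_intros fa_linear_comp[OF fa_linear_der] fa_linear_der)
  show "fa_der a (fa_der b (fa_word w)) - fa_der b (fa_der a (fa_word w)) = fa_der c (fa_word w)" for w
  proof (induction w)
    case (Cons i w)
    have "fa_der a (fa_der b (fa_word (i # w))) - fa_der b (fa_der a (fa_word (i # w)))
       = (fa_der a (b i) - fa_der b (a i)) * fa_word w
         + fa_var i * (fa_der a (fa_der b (fa_word w)) - fa_der b (fa_der a (fa_word w)))"
      by (simp add: fa_word_Cons fa_der_mult fa_der_var fa_linearD(1)[OF fa_linear_der] algebra_simps)
    also have "\<dots> = fa_der c (fa_word (i # w))"
      unfolding assms Cons.IH by (simp add: fa_word_Cons fa_der_mult fa_der_var)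
    finally show ?case .
  qed (simp add: fa_word_Nil fa_linear_zero[OF fa_linear_der])
qed (rule fa_linear_der)

definition fa_partial :: "'x \<Rightarrow> 'x free_alg \<Rightarrow> 'x free_alg" where
  "fa_partial x = fa_der (\<lambda>i. if i = x then 1 else 0)"

text \<open>The derivation \<open>E\<close> of the overview, the infinitesimal form of the
  transvection sending \<open>y\<close> to \<open>y + t x\<close>.\<close>

definition fa_shift :: "'x \<Rightarrow> 'x \<Rightarrow> 'x free_alg \<Rightarrow> 'x free_alg" where
  "fa_shift y x = fa_der (\<lambda>i. if i = y then fa_var x else 0)"

lemma fa_linear_partial: "fa_linear (fa_partial x)"
  by (simp add: fa_partial_def fa_linear_der)

lemma fa_linear_shift: "fa_linear (fa_shift y x)"
  by (simp add: fa_shift_def fa_linear_der)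

lemma fa_partial_var_mult:
  "fa_partial x (fa_var c * f) = fa_var c * fa_partial x f + (if c = x then f else 0)"
  by (simp add: fa_partial_def fa_der_mult fa_der_var)

lemma fa_shift_var_mult:
  "fa_shift y x (fa_var c * f) = fa_var c * fa_shift y x f + (if c = y then fa_var x * f else 0)"
  by (simp add: fa_shift_def fa_der_mult fa_der_var)

text \<open>Leibniz rule for a single letter, whose second derivative vanishes. At
  \<open>m = 0\<close> the truncated \<open>m - 1\<close> carries the coefficient 0.\<close>

lemma funpow_partial_var_mult:
  "(fa_partial x ^^ m) (fa_var c * f) = fa_var c * (fa_partial x ^^ m) f
     + (if c = x then fa_scale (of_nat m) ((fa_partial x ^^ (m - 1)) f) else 0)"
proof (induction m)
  case (Suc m)
  have "(fa_partial x ^^ Suc m) (fa_var c * f) = fa_partial x (fa_var c * (fa_partial x ^^ m) f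
     + (if c = x then fa_scale (of_nat m) ((fa_partial x ^^ (m - 1)) f) else 0))"
    by (simp add: Suc)
  also have "\<dots> = fa_var c * (fa_partial x ^^ Suc m) f
     + (if c = x then fa_scale (of_nat (Suc m)) ((fa_partial x ^^ m) f) else 0)"
    by (cases m) (simp_all add: fa_linearD(1,2)[OF fa_linear_partial] fa_partial_var_mult
        fa_linear_zero[OF fa_linear_partial] fa_scale_of_nat_Suc add.assoc del: of_nat_Suc)
  finally show ?case by simp
qed simp

lemma funpow_partial_word_eq_0: "length w < m \<Longrightarrow> (fa_partial x ^^ m) (fa_word w) = 0"
proof (induction w arbitrary: m)
  case Nil
  then obtain k where "m = Suc k" by (cases m) auto
  then show ?case
    by (simp only: funpow_Suc_right o_def fa_word_Nil fa_partial_def fa_der_1)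
      (simp add: fa_linear_zero[OF fa_linear_funpow[OF fa_linear_der]])
next
  case (Cons c w)
  then show ?case by (simp add: fa_word_Cons funpow_partial_var_mult)
qed

section \<open>Words with \<open>y\<close> acting by brackets, and the Taylor operator\<close>

fun proper_word :: "'x \<Rightarrow> 'x list \<Rightarrow> 'x free_alg" where
  "proper_word y [] = 1"
| "proper_word y (c # w) =
    (if c = y then commutator (fa_var y) (proper_word y w) else fa_var c * proper_word y w)"

lemma six_unit: "\<exists>c::'x free_alg. 6 * c = 1"
proof
  have "6 * Poly_Mapping.single 0 (1/6) = Poly_Mapping.single 0 (6::complex) * Poly_Mapping.single (0::'x free_monoid) (1/6)"
    by simp
  also have "\<dots> = 1"
    unfolding mult_single by simp
  finally show "6 * Poly_Mapping.single 0 (1/6) = (1 :: 'x free_alg)" .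
qed

text \<open>Each letter \<open>y\<close> acts by a bracket and raises the level by one; the other
  letters act by left multiplication, which preserves it.\<close>

lemma proper_word_ad_filtration: "proper_word y w \<in> ad_filtration (fa_var y) (count (mset w) y)"
proof (induction w)
  case Nil
  then show ?case by (simp add: ad_filtration_def lci_0)
next
  case (Cons c w)
  then show ?case
    using ad_filtration_commutator[OF six_unit] ad_filtration_mult_left by auto
qed

text \<open>The operator of the overview, cut off at \<open>N\<close>: on words of length at most
  \<open>N\<close> the omitted derivatives vanish.\<close>

definition taylor :: "'x \<Rightarrow> nat \<Rightarrow> 'x free_alg \<Rightarrow> 'x free_alg" where
  "taylor y N f = (\<Sum>i\<le>N. fa_scale ((-1) ^ i / fact i) ((fa_partial y ^^ i) f * fa_var y ^ i))"

lemma fa_linear_taylor: "fa_linear (taylor y N)"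
  unfolding taylor_def
  by (intro fa_linear_sum_fun fa_linear_intros fa_linear_funpow fa_linear_partial)

text \<open>For a leading \<open>y\<close> the extra Leibniz terms, after an index shift, sum to
  \<open>- (proper_word y w * fa_var y)\<close> and complete the bracket with
  \<open>y\<close>.\<close>

lemma taylor_word: "length w \<le> N \<Longrightarrow> taylor y N (fa_word w) = proper_word y w"
proof (induction w)
  case Nil
  have "(\<Sum>i\<le>N. fa_scale ((-1) ^ i / fact i) ((fa_partial y ^^ i) (fa_word []) * fa_var y ^ i))
      = (\<Sum>i\<in>{0}. fa_scale ((-1) ^ i / fact i) ((fa_partial y ^^ i) (fa_word []) * fa_var y ^ i))"
    by (rule sum.mono_neutral_right) (auto simp: funpow_partial_word_eq_0)
  then show ?case by (simp add: taylor_def fa_word_Nil)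
next
  case (Cons c w)
  let ?t = "\<lambda>i. fa_scale ((-1) ^ i / fact i) ((fa_partial y ^^ i) (fa_word w) * fa_var y ^ i)"
  have IH: "(\<Sum>i\<le>N. ?t i) = proper_word y w"
    using Cons unfolding taylor_def by simp
  have mult: "(\<Sum>i\<le>N. fa_scale ((-1) ^ i / fact i) (fa_var c * (fa_partial y ^^ i) (fa_word w) * fa_var y ^ i))
      = fa_var c * proper_word y w"
    unfolding IH[symmetric] by (simp add: sum_distrib_left fa_scale_mult_right mult.assoc)
  show ?case
  proof (cases "c = y")
    case False
    then show ?thesis
      using mult by (simp add: taylor_def fa_word_Cons funpow_partial_var_mult)
  next
    case True
    obtain M where N: "N = Suc M" using Cons.prems by (cases N) auto
    have "(\<Sum>i\<le>N. fa_scale ((-1) ^ i / fact i)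
          (fa_scale (of_nat i) ((fa_partial y ^^ (i - 1)) (fa_word w)) * fa_var y ^ i))
       = (\<Sum>i\<le>M. fa_scale ((-1) ^ Suc i / fact (Suc i))
          (fa_scale (of_nat (Suc i)) ((fa_partial y ^^ i) (fa_word w)) * fa_var y ^ Suc i))"
      unfolding N sum.atMost_Suc_shift by simp
    also have "\<dots> = (\<Sum>i\<le>M. - (?t i * fa_var y))"
    proof (rule sum.cong[OF refl])
      fix i
      have "(-1) ^ Suc i / fact (Suc i) * of_nat (Suc i) = - ((-1) ^ i / fact i :: complex)"
        by (simp add: field_simps del: of_nat_Suc)
      then show "fa_scale ((-1) ^ Suc i / fact (Suc i))
          (fa_scale (of_nat (Suc i)) ((fa_partial y ^^ i) (fa_word w)) * fa_var y ^ Suc i) = - (?t i * fa_var y)"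
        unfolding fa_scale_mult_left fa_scale_scale
        by (simp only: fa_scale_minus_left power_Suc2 mult.assoc)
    qed
    \<comment> \<open>Extending the sum from \<open>M\<close> to \<open>N = Suc M\<close> adds a
      zero term, because \<open>w\<close> is shorter than \<open>N\<close>.\<close>
    also have "\<dots> = - ((\<Sum>i\<le>N. ?t i) * fa_var y)"
      using funpow_partial_word_eq_0[of w N y] Cons.prems
      by (simp add: N sum_negf sum_distrib_right del: funpow.simps)
    finally have shift: "(\<Sum>i\<le>N. fa_scale ((-1) ^ i / fact i)
        (fa_scale (of_nat i) ((fa_partial y ^^ (i - 1)) (fa_word w)) * fa_var y ^ i)) = - (proper_word y w * fa_var y)"
      unfolding IH .
    have "taylor y N (fa_word (c # w)) = fa_var c * proper_word y w - proper_word y w * fa_var y"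
      using mult shift True
      by (simp add: taylor_def fa_word_Cons funpow_partial_var_mult distrib_right fa_scale_add_right sum.distrib)
    then show ?thesis
      using True by (simp add: commutator_def)
  qed
qed

lemma funpow_partial_lci: "f \<in> lci p \<Longrightarrow> (fa_partial y ^^ i) f \<in> lci p"
  by (induction i) (simp_all add: fa_partial_def fa_der_lci)

text \<open>The Taylor operator sends \<open>f\<close> to \<open>f\<close> plus terms built from
  derivatives of \<open>fa_partial y f\<close>, while its value is in \<open>lci p\<close> by the
  count of \<open>y\<close>.\<close>

lemma partial_in_lci_imp:
  assumes cnt: "\<And>w. w \<in> Poly_Mapping.keys f \<Longrightarrow> p \<le> count (mset (letters w)) y"
    and d: "fa_partial y f \<in> lci p"
  shows "f \<in> lci p"
proof -
  define N where "N = Max (insert 0 ((\<lambda>w. length (letters w)) ` Poly_Mapping.keys f))"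
  have "taylor y N f \<in> lci p"
  proof (rule fa_linear_in_lci[OF fa_linear_taylor])
    fix w assume w: "w \<in> Poly_Mapping.keys f"
    then have "length (letters w) \<le> N"
      unfolding N_def by (intro Max_ge) auto
    then show "taylor y N (fa_word (letters w)) \<in> lci p"
      using taylor_word ad_filtration_subset_lci[OF six_unit proper_word_ad_filtration]
        lci_antimono[OF cnt[OF w]] by metis
  qed
  moreover define r where
    "r = (\<Sum>i<N. fa_scale ((-1) ^ Suc i / fact (Suc i)) ((fa_partial y ^^ Suc i) f * fa_var y ^ Suc i))"
  have "r \<in> lci p"
    unfolding r_def using funpow_partial_lci[OF d]
    by (intro additive_subgroup_sum additive_subgroup_lci lci_fa_scale lci_mult_right)
      (simp add: funpow_Suc_right del: funpow.simps)
  ultimately have "taylor y N f - r \<in> lci p"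
    by (rule lci_closed(4))
  moreover have "taylor y N f = f + r"
    unfolding taylor_def r_def sum.atMost_shift by simp
  ultimately show ?thesis
    by simp
qed

section \<open>Multidegrees and the descending induction\<close>

lemma keys_var_mult:
  "v \<in> Poly_Mapping.keys (fa_var i * f) \<Longrightarrow> \<exists>u\<in>Poly_Mapping.keys f. letters v = i # letters u"
  using keys_mult[of "fa_var i" f] by (fastforce simp: fa_var_def plus_free_monoid_def)

lemma keys_partial_word:
  "v \<in> Poly_Mapping.keys (fa_partial x (fa_word w)) \<Longrightarrow> add_mset x (mset (letters v)) = mset w"
proof (induction w arbitrary: v)
  case (Cons i w)
  have "fa_partial x (fa_word (i # w)) = fa_var i * fa_partial x (fa_word w) + (if i = x then fa_word w else 0)"
    by (simp add: fa_word_Cons fa_partial_var_mult)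
  then consider "v \<in> Poly_Mapping.keys (fa_var i * fa_partial x (fa_word w))" | "i = x" "v = FM w"
    using Cons.prems Poly_Mapping.keys_add[of "fa_var i * fa_partial x (fa_word w)" "if i = x then fa_word w else 0"]
    by (auto split: if_splits)
  then show ?case
    by cases (use Cons.IH keys_var_mult in \<open>fastforce+\<close>)
qed (simp add: fa_word_Nil fa_partial_def)

text \<open>Adding a letter on both sides avoids a truncated multiset difference.\<close>

lemma keys_shift_word:
  "v \<in> Poly_Mapping.keys (fa_shift y x (fa_word w)) \<Longrightarrow>
    add_mset y (mset (letters v)) = add_mset x (mset w)"
proof (induction w arbitrary: v)
  case (Cons i w)
  have "fa_shift y x (fa_word (i # w)) = fa_var i * fa_shift y x (fa_word w) + (if i = y then fa_word (x # w) else 0)"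
    by (simp add: fa_word_Cons fa_shift_var_mult)
  then consider "v \<in> Poly_Mapping.keys (fa_var i * fa_shift y x (fa_word w))" | "i = y" "v = FM (x # w)"
    using Cons.prems Poly_Mapping.keys_add[of "fa_var i * fa_shift y x (fa_word w)" "if i = y then fa_word (x # w) else 0"]
    by (auto split: if_splits)
  then show ?case
  proof cases
    case 1
    then obtain u where u: "u \<in> Poly_Mapping.keys (fa_shift y x (fa_word w))" "letters v = i # letters u"
      using keys_var_mult[OF 1] by blast
    have "add_mset i (add_mset y (mset (letters u))) = add_mset i (add_mset x (mset w))"
      unfolding Cons.IH[OF u(1)] ..
    then show ?thesis
      unfolding u(2) mset.simps add_mset_commute[of _ i] .
  qed simp
qed (simp add: fa_word_Nil fa_shift_def)

lemma keys_partial: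
  assumes "v \<in> Poly_Mapping.keys (fa_partial x f)"
  shows "\<exists>w\<in>Poly_Mapping.keys f. add_mset x (mset (letters v)) = mset (letters w)"
proof (rule ccontr)
  assume "\<not> ?thesis"
  then have "Poly_Mapping.lookup (fa_partial x f) v = 0"
    unfolding fa_linear_expand[OF fa_linear_partial, of x f] lookup_sum lookup_fa_scale
    by (intro sum.neutral) (use keys_partial_word in \<open>fastforce simp: in_keys_iff\<close>)
  then show False using assms by (simp add: in_keys_iff)
qed

text \<open>Induction on \<open>m\<close>, moving \<open>fa_shift y x\<close> past one
  \<open>fa_partial x\<close> at a time; each move leaves a \<open>fa_partial y\<close>, which
  commutes with \<open>fa_partial x\<close>.\<close>

lemma shift_partial_funpow:
  assumes "fa_shift y x f = 0" "x \<noteq> y"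
  shows "fa_shift y x ((fa_partial x ^^ m) f) = fa_scale (- of_nat m) (fa_partial y ((fa_partial x ^^ (m - 1)) f))"
proof (induction m)
  case (Suc m)
  have comm: "fa_partial x (fa_shift y x g) - fa_shift y x (fa_partial x g) = fa_partial y g" for g
    unfolding fa_partial_def fa_shift_def
    by (rule fa_der_commute) (use assms(2) in \<open>auto simp: fa_der_var fa_linear_zero[OF fa_linear_der]\<close>)
  have pcomm: "fa_partial x (fa_partial y g) = fa_partial y (fa_partial x g)" for g
  proof -
    have "fa_partial x (fa_partial y g) - fa_partial y (fa_partial x g) = fa_der (\<lambda>i. 0) g"
      unfolding fa_partial_def by (rule fa_der_commute) (auto simp: fa_linear_zero[OF fa_linear_der])
    \<comment> \<open>Bracketing the derivation with itself shows that it is zero.\<close>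
    moreover have "fa_der (\<lambda>i. 0) g = 0"
      using fa_der_commute[of "\<lambda>i. 0" "\<lambda>i. 0" "\<lambda>i. 0" g] by (simp add: fa_linear_zero[OF fa_linear_der])
    ultimately show ?thesis by simp
  qed
  have "fa_shift y x ((fa_partial x ^^ Suc m) f)
      = fa_partial x (fa_shift y x ((fa_partial x ^^ m) f)) - fa_partial y ((fa_partial x ^^ m) f)"
    using comm[of "(fa_partial x ^^ m) f"] by (simp add: algebra_simps)
  also have "\<dots> = fa_scale (- of_nat (Suc m)) (fa_partial y ((fa_partial x ^^ m) f))"
  proof (cases m)
    case 0
    then show ?thesis
      using assms by (simp add: fa_linear_zero[OF fa_linear_partial] fa_scale_minus_left)
  next
    case (Suc k)
    have "fa_partial x (fa_partial y ((fa_partial x ^^ k) f)) = fa_partial y ((fa_partial x ^^ m) f)"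
      by (simp add: pcomm Suc)
    then show ?thesis
      unfolding Suc.IH
      by (simp add: Suc fa_linearD(2)[OF fa_linear_partial] fa_linear_diff[OF fa_linear_partial]
          fa_linear_minus[OF fa_linear_partial] fa_scale_minus_left fa_scale_of_nat_Suc
          del: of_nat_Suc)
  qed
  finally show ?case by simp
qed (simp add: assms)

lemma shift_invariant_in_lci:
  assumes "x \<noteq> y" and inv: "fa_shift y x f = 0"
    and cnt: "\<And>w. w \<in> Poly_Mapping.keys f \<Longrightarrow> p \<le> count (mset (letters w)) y"
  shows "f \<in> lci p"
proof -
  let ?g = "\<lambda>m. (fa_partial x ^^ m) f"
  \<comment> \<open>\<open>N\<close> exceeds every word length, so \<open>?g N = 0\<close> starts
    the descent.\<close>
  define N where "N = Suc (Max (insert 0 ((\<lambda>w. length (letters w)) ` Poly_Mapping.keys f)))"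
  have "?g N = 0"
    unfolding fa_linear_expand[OF fa_linear_funpow[OF fa_linear_partial], of N x f]
  proof (intro sum.neutral ballI)
    fix w assume "w \<in> Poly_Mapping.keys f"
    then have "length (letters w) < N"
      unfolding N_def less_Suc_eq_le by (intro Max_ge) auto
    then show "fa_scale (Poly_Mapping.lookup f w) ((fa_partial x ^^ N) (fa_word (letters w))) = 0"
      by (simp add: funpow_partial_word_eq_0)
  qed
  \<comment> \<open>As \<open>x\<close> differs from \<open>y\<close>, differentiating by
    \<open>x\<close> keeps the number of letters \<open>y\<close>.\<close>
  have cnt': "p \<le> count (mset (letters w)) y" if "w \<in> Poly_Mapping.keys (?g m)" for w m
    using that
  proof (induction m arbitrary: w)
    case (Suc m)
    then obtain u where "u \<in> Poly_Mapping.keys (?g m)" "add_mset x (mset (letters w)) = mset (letters u)"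
      using keys_partial by fastforce
    then show ?case using Suc.IH[of u] \<open>x \<noteq> y\<close> by (metis count_add_mset)
  qed (use cnt in simp)
  have "?g (N - i) \<in> lci p" if "i \<le> N" for i
    using that
  proof (induction i)
    case 0
    then show ?case using \<open>?g N = 0\<close> lci_closed(1) by simp
  next
    case (Suc i)
    define m where "m = N - Suc i"
    have m: "N - i = Suc m" using Suc.prems by (simp add: m_def)
    have "fa_shift y x (?g (Suc m)) \<in> lci p"
      using Suc m unfolding fa_shift_def by (metis Suc_leD fa_der_lci)
    then have "fa_scale (- 1 / of_nat (Suc m)) (fa_scale (- of_nat (Suc m)) (fa_partial y (?g m))) \<in> lci p"
      using shift_partial_funpow[OF inv \<open>x \<noteq> y\<close>, of "Suc m"] lci_fa_scale by simp
    then have "fa_partial y (?g m) \<in> lci p"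
      unfolding fa_scale_scale by (simp del: of_nat_Suc)
    then show ?case
      unfolding m_def[symmetric] by (rule partial_in_lci_imp[rotated]) (rule cnt')
  qed
  from this[of N] show ?thesis by simp
qed

section \<open>Multihomogeneous components\<close>

definition fa_restrict :: "('x list \<Rightarrow> bool) \<Rightarrow> 'x free_alg \<Rightarrow> 'x free_alg" where
  "fa_restrict P = fa_extend (\<lambda>w. if P w then fa_word w else 0)"

lemma fa_linear_restrict: "fa_linear (fa_restrict P)"
  by (simp add: fa_restrict_def fa_linear_extend)

lemma lookup_fa_restrict:
  "Poly_Mapping.lookup (fa_restrict P f) v = (if P (letters v) then Poly_Mapping.lookup f v else 0)"
proof -
  have "Poly_Mapping.lookup (fa_restrict P f) v
      = (\<Sum>w\<in>Poly_Mapping.keys f. if v = w then (if P (letters v) then Poly_Mapping.lookup f v else 0) else 0)"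
    unfolding fa_restrict_def fa_extend_def lookup_sum lookup_fa_scale by (rule sum.cong) auto
  then show ?thesis by (simp add: in_keys_iff)
qed

text \<open>\<open>fa_shift y x\<close> exchanges one \<open>y\<close> for one \<open>x\<close>, so
  it maps the component of content \<open>M\<close> into a single component. Hence the components of
  an element that it kills are killed too.\<close>

lemma fa_shift_restrict:
  "fa_shift y x (fa_restrict (\<lambda>w. mset w = M) f)
    = fa_restrict (\<lambda>w. add_mset y (mset w) = add_mset x M) (fa_shift y x f)"
proof (rule fa_linear_eqI[OF fa_linear_comp[OF fa_linear_shift fa_linear_restrict]
      fa_linear_comp[OF fa_linear_restrict fa_linear_shift]])
  fix w :: "'a list"
  show "fa_shift y x (fa_restrict (\<lambda>w. mset w = M) (fa_word w))
    = fa_restrict (\<lambda>w. add_mset y (mset w) = add_mset x M) (fa_shift y x (fa_word w))"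
  proof (rule poly_mapping_eqI)
    fix v
    show "Poly_Mapping.lookup (fa_shift y x (fa_restrict (\<lambda>w. mset w = M) (fa_word w))) v
      = Poly_Mapping.lookup (fa_restrict (\<lambda>w. add_mset y (mset w) = add_mset x M) (fa_shift y x (fa_word w))) v"
      using keys_shift_word[of v y x w]
      by (cases "v \<in> Poly_Mapping.keys (fa_shift y x (fa_word w))") (auto simp: lookup_fa_restrict in_keys_iff fa_restrict_def[of "\<lambda>w. mset w = M"] fa_linear_zero[OF fa_linear_shift])
  qed
qed

lemma shift_invariants_in_lci:
  fixes f :: "'n::finite free_alg"
  assumes hom: "homogeneous_of_degree d f" and d: "d > CARD('n) * (p - 1)"
    and inv: "\<And>i. \<exists>j. j \<noteq> i \<and> fa_shift i j f = 0"
  shows "f \<in> lci p"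
proof -
  let ?part = "\<lambda>M. fa_restrict (\<lambda>w. mset w = M) f"
  let ?K = "(\<lambda>w. mset (letters w)) ` Poly_Mapping.keys f"
  have "?part M \<in> lci p" if "M \<in> ?K" for M
  proof -
    have "(\<Sum>i\<in>UNIV. count M i) = d"
    proof -
      have "size M = d"
        using that hom by (auto simp: homogeneous_of_degree_def)
      moreover have "size M = (\<Sum>i\<in>UNIV. count M i)"
        unfolding size_multiset_overloaded_eq
        by (rule sum.mono_neutral_left) (auto simp: not_in_iff)
      ultimately show ?thesis by simp
    qed
    moreover have "(\<Sum>i\<in>UNIV. count M i) \<le> (\<Sum>i\<in>(UNIV::'n set). p - 1)" if "\<forall>i. count M i \<le> p - 1"
      using that by (intro sum_mono) auto
    \<comment> \<open>Pigeonhole: the multiplicities add up to \<open>d\<close>, which exceeds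
      \<open>CARD('n) * (p - 1)\<close>.\<close>
    ultimately obtain y where y: "p - 1 < count M y"
      using d by (metis card_eq_sum linorder_not_less mult.right_neutral mult.commute sum_constant of_nat_id)
    obtain x where x: "x \<noteq> y" "fa_shift y x f = 0"
      using inv by blast
    show ?thesis
    proof (rule shift_invariant_in_lci[OF x(1)])
      show "fa_shift y x (?part M) = 0"
        by (simp add: fa_shift_restrict x(2) fa_linear_zero[OF fa_linear_restrict])
      show "p \<le> count (mset (letters w)) y" if "w \<in> Poly_Mapping.keys (?part M)" for w
        using that y by (auto simp: in_keys_iff lookup_fa_restrict split: if_splits)
    qed
  qed
  then have "(\<Sum>M\<in>?K. ?part M) \<in> lci p"
    by (intro additive_subgroup_sum additive_subgroup_lci)
  moreover have "f = (\<Sum>M\<in>?K. ?part M)"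
    by (rule poly_mapping_eqI) (auto simp: lookup_sum lookup_fa_restrict in_keys_iff)
  ultimately show ?thesis by simp
qed

section \<open>Group actions and transvections\<close>

definition fa_hom :: "('x \<Rightarrow> 'y free_alg) \<Rightarrow> 'x free_alg \<Rightarrow> 'y free_alg" where
  "fa_hom a = fa_extend (\<lambda>w. prod_list (map a w))"

lemma fa_linear_hom: "fa_linear (fa_hom a)"
  by (simp add: fa_hom_def fa_linear_extend)

lemma fa_hom_word: "fa_hom a (fa_word w) = prod_list (map a w)"
  by (simp add: fa_hom_def)

lemma fa_hom_var: "fa_hom a (fa_var i) = a i"
  unfolding fa_word_single[symmetric] fa_hom_word by simp

lemma fa_hom_1 [simp]: "fa_hom a 1 = 1"
  unfolding fa_word_Nil[symmetric] fa_hom_word by (simp add: fa_word_Nil)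

lemma fa_hom_mult: "fa_hom a (f * g) = fa_hom a f * fa_hom a g"
proof (rule fa_bilinear_eqI[where B = "\<lambda>f g. fa_hom a (f * g)" and C = "\<lambda>f g. fa_hom a f * fa_hom a g"])
  show "fa_hom a (fa_word u * fa_word v) = fa_hom a (fa_word u) * fa_hom a (fa_word v)" for u v
    unfolding fa_word_append[symmetric] fa_hom_word by simp
qed (intro fa_linear_intros fa_linear_comp[OF fa_linear_hom] fa_linear_hom)+

lemma fa_hom_prod_list: "fa_hom a (prod_list fs) = prod_list (map (fa_hom a) fs)"
  by (induction fs) (simp_all add: fa_hom_mult)

lemma fa_hom_hom: "fa_hom a (fa_hom b f) = fa_hom (\<lambda>i. fa_hom a (b i)) f"
  by (rule fa_linear_eqI[OF fa_linear_comp[OF fa_linear_hom fa_linear_hom] fa_linear_hom])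
    (simp add: fa_hom_word fa_hom_prod_list o_def)

lemma prod_list_fa_var: "prod_list (map fa_var w) = fa_word w"
  by (induction w) (simp_all add: fa_word_Nil fa_word_Cons)

lemma fa_hom_fa_var: "fa_hom fa_var f = f"
  by (rule fa_linear_eqI[OF fa_linear_hom fa_linear_intros(1)]) (simp add: fa_hom_word prod_list_fa_var)

lemma fa_act_eq_hom: "fa_act g = fa_hom (\<lambda>i. fa_vec (g *v axis i 1))"
  by (simp add: fun_eq_iff fa_act_def fa_hom_def fa_extend_def)

lemma fa_vec_add: "fa_vec (u + v) = fa_vec u + fa_vec v"
  and fa_vec_scale: "fa_vec (c *s v) = fa_scale c (fa_vec v)"
  and fa_vec_zero: "fa_vec 0 = 0"
  by (simp_all add: fa_vec_def fa_scale_add_left sum.distrib fa_scale_sum fa_scale_scale)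

lemma fa_vec_sum: "fa_vec (sum h I) = (\<Sum>i\<in>I. fa_vec (h i))"
  by (induction I rule: infinite_finite_induct) (simp_all add: fa_vec_zero fa_vec_add)

lemma fa_vec_axis: "fa_vec (axis i 1) = fa_var i"
proof -
  have "fa_vec (axis i 1) = (\<Sum>j\<in>UNIV. if j = i then fa_var j else 0)"
    unfolding fa_vec_def by (rule sum.cong) (auto simp: axis_def)
  then show ?thesis by simp
qed

lemma matrix_vector_mult_axis: "A *v axis k 1 = column k (A :: 'a::comm_semiring_1 ^ 'n ^ 'm)"
  by (simp add: vec_eq_iff matrix_vector_mult_def column_def axis_def if_distrib[of "\<lambda>x. _ * x"]
      cong: if_cong)

lemma fa_act_vec: "fa_act g (fa_vec v) = fa_vec (g *v v)"
proof -
  have "fa_act g (fa_vec v) = (\<Sum>i\<in>UNIV. fa_scale (v $ i) (fa_vec (g *v axis i 1)))"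
    by (simp add: fa_vec_def[of v] fa_act_eq_hom fa_linear_sum[OF fa_linear_hom]
        fa_linearD(2)[OF fa_linear_hom] fa_hom_var)
  also have "\<dots> = fa_vec (g *v v)"
    unfolding matrix_mult_sum[of g v] by (simp add: fa_vec_sum fa_vec_scale matrix_vector_mult_axis)
  finally show ?thesis .
qed

lemma fa_act_act: "fa_act g (fa_act h f) = fa_act (g ** h) f"
proof -
  have "fa_act g (fa_act h f) = fa_hom (\<lambda>i. fa_act g (fa_vec (h *v axis i 1))) f"
    by (simp add: fa_act_eq_hom fa_hom_hom)
  then show ?thesis
    by (simp add: fa_act_vec fa_act_eq_hom[of "g ** h"] matrix_vector_mul_assoc)
qed

lemma fa_act_mat_1: "fa_act (mat 1) f = f"
  by (simp add: fa_act_eq_hom fa_vec_axis fa_hom_fa_var)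

lemma fa_act_lci: "f \<in> lci p \<Longrightarrow> fa_act g f \<in> lci p"
  unfolding fa_act_eq_hom by (rule ring_hom_lci[OF fa_linearD(3)[OF fa_linear_hom] fa_hom_mult])

lemma homogeneous_intros:
  "homogeneous_of_degree d 0"
  "homogeneous_of_degree d f \<Longrightarrow> homogeneous_of_degree d g \<Longrightarrow> homogeneous_of_degree d (f + g)"
  "homogeneous_of_degree d f \<Longrightarrow> homogeneous_of_degree d (fa_scale c f)"
  "homogeneous_of_degree d f \<Longrightarrow> homogeneous_of_degree e g \<Longrightarrow> homogeneous_of_degree (d + e) (f * g)"
  "homogeneous_of_degree (length w) (fa_word w)"
proof -
  show "homogeneous_of_degree d f \<Longrightarrow> homogeneous_of_degree d g \<Longrightarrow> homogeneous_of_degree d (f + g)"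
    using Poly_Mapping.keys_add[of f g] by (auto simp: homogeneous_of_degree_def)
  show "homogeneous_of_degree d f \<Longrightarrow> homogeneous_of_degree d (fa_scale c f)"
    by (auto simp: homogeneous_of_degree_def in_keys_iff lookup_fa_scale)
  show "homogeneous_of_degree d f \<Longrightarrow> homogeneous_of_degree e g \<Longrightarrow> homogeneous_of_degree (d + e) (f * g)"
    using keys_mult[of f g] by (fastforce simp: homogeneous_of_degree_def plus_free_monoid_def)
qed (simp_all add: homogeneous_of_degree_def)

lemma homogeneous_sum:
  "(\<And>i. i \<in> I \<Longrightarrow> homogeneous_of_degree d (h i)) \<Longrightarrow> homogeneous_of_degree d (sum h I)"
  by (induction I rule: infinite_finite_induct) (simp_all add: homogeneous_intros)

lemma homogeneous_act:
  assumes "homogeneous_of_degree d f"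
  shows "homogeneous_of_degree d (fa_act g f)"
proof -
  have vec: "homogeneous_of_degree 1 (fa_vec v)" for v :: "complex ^ 'a"
    unfolding fa_vec_def fa_word_single[symmetric]
    using homogeneous_intros(5)[of "[_]"] by (intro homogeneous_sum homogeneous_intros(3)) simp
  have "homogeneous_of_degree (length w) (prod_list (map (\<lambda>i. fa_vec (g *v axis i 1)) w))" for w
  proof (induction w)
    case Nil
    then show ?case using homogeneous_intros(5)[of "[]"] by (simp add: fa_word_Nil)
  next
    case (Cons i w)
    then show ?case using homogeneous_intros(4)[OF vec] by fastforce
  qed
  then show ?thesis
    unfolding fa_act_def using assms
    by (intro homogeneous_sum homogeneous_intros(3)) (metis homogeneous_of_degree_def)
qed

section \<open>From one-parameter families to derivations\<close>

text \<open>Working coefficient by coefficient leaves scalar calculus only. The arbitrary left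
  factor \<open>h\<close> absorbs the head letter in the induction.\<close>

lemma DERIV_lookup_prod_list:
  "((\<lambda>c. Poly_Mapping.lookup (h * prod_list (map (\<lambda>i. fa_var i + fa_scale c (a i)) w)) v)
     has_field_derivative Poly_Mapping.lookup (h * fa_der_word a w) v) (at 0)"
proof (induction w arbitrary: h)
  case (Cons i w)
  let ?P = "\<lambda>c. prod_list (map (\<lambda>i. fa_var i + fa_scale c (a i)) w)"
  have "((\<lambda>c. Poly_Mapping.lookup (h * fa_var i * ?P c) v + c * Poly_Mapping.lookup (h * a i * ?P c) v)
     has_field_derivative Poly_Mapping.lookup (h * fa_var i * fa_der_word a w) v
       + (1 * Poly_Mapping.lookup (h * a i * ?P 0) v + Poly_Mapping.lookup (h * a i * fa_der_word a w) v * 0)) (at 0)"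
    by (intro DERIV_add DERIV_mult DERIV_ident Cons.IH)
  moreover have "?P 0 = fa_word w"
    by (simp add: prod_list_fa_var)
  ultimately show ?case
    by (simp add: algebra_simps lookup_add lookup_fa_scale fa_scale_mult_left fa_scale_mult_right)
qed simp

text \<open>The coefficients of the image of \<open>f\<close> are constant in \<open>c\<close>,
  while their derivatives at 0 are the coefficients of \<open>fa_der a f\<close>.\<close>

lemma fa_hom_invariant_imp_der_eq_0:
  assumes "\<And>c. fa_hom (\<lambda>i. fa_var i + fa_scale c (a i)) f = f"
  shows "fa_der a f = 0"
proof (rule poly_mapping_eqI)
  fix v
  let ?P = "\<lambda>c w. prod_list (map (\<lambda>i. fa_var i + fa_scale c (a i)) (letters w))"
  have "((\<lambda>c. \<Sum>w\<in>Poly_Mapping.keys f. Poly_Mapping.lookup f w * Poly_Mapping.lookup (1 * ?P c w) v)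
      has_field_derivative (\<Sum>w\<in>Poly_Mapping.keys f. Poly_Mapping.lookup f w *
        Poly_Mapping.lookup (1 * fa_der_word a (letters w)) v)) (at 0)"
    by (intro DERIV_sum DERIV_cmult DERIV_lookup_prod_list)
  moreover have "(\<lambda>c. \<Sum>w\<in>Poly_Mapping.keys f. Poly_Mapping.lookup f w * Poly_Mapping.lookup (1 * ?P c w) v)
      = (\<lambda>c. Poly_Mapping.lookup (fa_hom (\<lambda>i. fa_var i + fa_scale c (a i)) f) v)"
    by (simp add: fa_hom_def fa_extend_def lookup_sum lookup_fa_scale)
  ultimately have "((\<lambda>c. Poly_Mapping.lookup f v) has_field_derivative Poly_Mapping.lookup (fa_der a f) v) (at 0)"
    unfolding assms by (simp add: fa_der_def fa_extend_def lookup_sum lookup_fa_scale)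
  then show "Poly_Mapping.lookup (fa_der a f) v = Poly_Mapping.lookup 0 v"
    using DERIV_unique[OF _ DERIV_const] by fastforce
qed

lemma transvection_invariant_imp_shift_eq_0:
  assumes inv: "\<And>c. fa_act (T c) f = f"
    and T: "\<And>c i. T c *v axis i 1 = axis i 1 + (if i = y then c *s axis x 1 else 0)"
  shows "fa_shift y x f = 0"
  unfolding fa_shift_def
proof (rule fa_hom_invariant_imp_der_eq_0)
  fix c
  have "fa_vec (T c *v axis i 1) = fa_var i + fa_scale c (if i = y then fa_var x else 0)" for i
    by (simp add: T fa_vec_add fa_vec_axis fa_vec_scale fa_vec_zero)
  then show "fa_hom (\<lambda>i. fa_var i + fa_scale c (if i = y then fa_var x else 0)) f = f"
    using inv[of c] by (simp add: fa_act_eq_hom)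
qed

lemma SL_invariant_imp_shift_eq_0:
  assumes inv: "is_invariant SL_group f" and "x \<noteq> y"
  shows "fa_shift y x f = 0"
proof (rule transvection_invariant_imp_shift_eq_0)
  \<comment> \<open>The elementary matrix adding \<open>c\<close> times row \<open>y\<close> to row
    \<open>x\<close> of the identity; its column \<open>y\<close> is the image of the basis vector
    \<open>y\<close>.\<close>
  define T :: "complex \<Rightarrow> complex ^ 'a ^ 'a" where
    "T c = (\<chi> k. if k = x then row x (mat 1) + c *s row y (mat 1) else row k (mat 1))" for c
  show "fa_act (T c) f = f" for c
    using inv det_row_operation[OF assms(2), of "mat 1" c]
    by (simp add: is_invariant_def SL_group_def T_def)
  show "T c *v axis i 1 = axis i 1 + (if i = y then c *s axis x 1 else 0)" for c i
    unfolding matrix_vector_mult_axis using assms(2)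
    by (auto simp: T_def vec_eq_iff column_def row_def mat_def axis_def)
qed

section \<open>Symplectic bases and the symplectic group\<close>

text \<open>The Gram matrix of a symplectic basis whose hyperbolic pairs have the indices
  \<open>2 * m\<close> and \<open>2 * m + 1\<close>.\<close>

definition standard_form :: "nat \<Rightarrow> nat \<Rightarrow> complex" where
  "standard_form i j = (if even i \<and> j = Suc i then 1 else if odd i \<and> i = Suc j then - 1 else 0)"

context
  fixes \<omega> :: "complex ^ 'n::finite \<Rightarrow> complex ^ 'n \<Rightarrow> complex"
  assumes \<omega>: "symplectic_form \<omega>"
begin

lemma form_linear_left: "Vector_Spaces.linear (*s) (*) (\<lambda>u. \<omega> u v)"
  and form_linear_right: "Vector_Spaces.linear (*s) (*) (\<omega> u)"
  and form_skew: "\<omega> u v = - \<omega> v u"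
  and form_nondegenerate: "(\<And>v. \<omega> u v = 0) \<Longrightarrow> u = 0"
  using \<omega> unfolding symplectic_form_def by blast+

lemma form_simps:
  "\<omega> (u + u') v = \<omega> u v + \<omega> u' v" "\<omega> (u - u') v = \<omega> u v - \<omega> u' v" "\<omega> (c *s u) v = c * \<omega> u v"
  "\<omega> v (u + u') = \<omega> v u + \<omega> v u'" "\<omega> v (u - u') = \<omega> v u - \<omega> v u'" "\<omega> v (c *s u) = c * \<omega> v u"
  "\<omega> 0 v = 0" "\<omega> v 0 = 0" "\<omega> v v = 0"
  "\<omega> (sum h I) v = (\<Sum>i\<in>I. \<omega> (h i) v)" "\<omega> v (sum h I) = (\<Sum>i\<in>I. \<omega> v (h i))"
proof -
  interpret l: Vector_Spaces.linear "(*s)" "(*)" "\<lambda>u. \<omega> u v" by (rule form_linear_left)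
  interpret r: Vector_Spaces.linear "(*s)" "(*)" "\<omega> v" by (rule form_linear_right)
  show "\<omega> (u + u') v = \<omega> u v + \<omega> u' v" "\<omega> (u - u') v = \<omega> u v - \<omega> u' v"
    "\<omega> (c *s u) v = c * \<omega> u v" "\<omega> 0 v = 0" "\<omega> (sum h I) v = (\<Sum>i\<in>I. \<omega> (h i) v)"
    by (simp_all add: l.add l.diff l.scale l.zero l.sum)
  show "\<omega> v (u + u') = \<omega> v u + \<omega> v u'" "\<omega> v (u - u') = \<omega> v u - \<omega> v u'"
    "\<omega> v (c *s u) = c * \<omega> v u" "\<omega> v 0 = 0" "\<omega> v (sum h I) = (\<Sum>i\<in>I. \<omega> v (h i))"
    by (simp_all add: r.add r.diff r.scale r.zero r.sum)
  show "\<omega> v v = 0"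
    using form_skew[of v v] by simp
qed

text \<open>Symplectic transvections. Preserving a non-degenerate form forces a trivial kernel,
  hence invertibility.\<close>

lemma transvection_in_Sp:
  "\<exists>g\<in>Sp_group \<omega>. \<forall>v. g *v v = v + (c * \<omega> v u) *s u"
proof -
  let ?t = "\<lambda>v. v + (c * \<omega> v u) *s u"
  have "Vector_Spaces.linear (*s) (*s) ?t"
    by unfold_locales (simp_all add: form_simps vec_eq_iff algebra_simps)
  then have g: "matrix ?t *v v = ?t v" for v
    by (rule matrix_works)
  have pres: "\<omega> (?t v) (?t w) = \<omega> v w" for v w
    using form_skew[of u w] by (simp add: form_simps algebra_simps)
  have ker: "v = 0" if "?t v = 0" for v
  proof (rule form_nondegenerate)
    show "\<omega> v w = 0" for w
      using pres[of v w] unfolding that by (simp add: form_simps)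
  qed
  have "invertible (matrix ?t)"
    unfolding invertible_left_inverse matrix_left_invertible_ker g using ker by blast
  then show ?thesis
    using g pres by (intro bexI[of _ "matrix ?t"]) (simp_all add: Sp_group_def)
qed

text \<open>Symplectic Gram-Schmidt: a vector outside the present span is made orthogonal to it,
  non-degeneracy provides a partner, and the partner is made orthogonal too.\<close>

lemma symplectic_family:
  "2 * k \<le> CARD('n) \<Longrightarrow>
    \<exists>b :: nat \<Rightarrow> complex ^ 'n. \<forall>i<2 * k. \<forall>j<2 * k. \<omega> (b i) (b j) = standard_form i j"
proof (induction k)
  case (Suc k)
  then obtain b :: "nat \<Rightarrow> complex ^ 'n"
    where b: "\<And>i j. i < 2 * k \<Longrightarrow> j < 2 * k \<Longrightarrow> \<omega> (b i) (b j) = standard_form i j"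
    by auto
  \<comment> \<open>\<open>\<tau>\<close> exchanges the two indices of a hyperbolic pair;
    \<open>\<epsilon>\<close> holds the sign of the pairing.\<close>
  define \<tau> :: "nat \<Rightarrow> nat" where "\<tau> i = (if even i then Suc i else i - 1)" for i
  define \<epsilon> :: "nat \<Rightarrow> complex" where "\<epsilon> i = (if even i then 1 else - 1)" for i
  have \<tau>_less: "\<tau> i < 2 * k" if "i < 2 * k" for i
    using that by (cases "even i") (auto simp: \<tau>_def elim!: evenE)
  have form: "standard_form i j = (if i = \<tau> j then \<epsilon> i else 0)" for i j
    by (auto simp: standard_form_def \<tau>_def \<epsilon>_def elim: oddE)
  define proj where "proj u = u - (\<Sum>i<2 * k. (\<epsilon> i * \<omega> u (b (\<tau> i))) *s b i)" for u
  have \<tau>\<tau>: "\<tau> (\<tau> j) = j" for j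
    by (auto simp: \<tau>_def elim: oddE)
  have orth: "\<omega> (proj u) (b j) = 0" if "j < 2 * k" for u j
  proof -
    have "(\<Sum>i<2 * k. \<epsilon> i * \<omega> u (b (\<tau> i)) * \<omega> (b i) (b j))
        = (\<Sum>i<2 * k. if i = \<tau> j then \<omega> u (b j) else 0)"
      using that by (intro sum.cong) (auto simp: b form \<tau>\<tau> \<epsilon>_def)
    also have "\<dots> = \<omega> u (b j)"
      using \<tau>_less[OF that] by simp
    finally show ?thesis by (simp add: proj_def form_simps)
  qed
  have "vec.dim (vec.span (b ` {..<2 * k})) \<le> card (b ` {..<2 * k})"
    by (rule vec.dim_le_card) auto
  also have "\<dots> < CARD('n)"
    using card_image_le[of "{..<2 * k}" b] Suc.prems by simp
  finally have "vec.span (b ` {..<2 * k}) \<noteq> UNIV"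
    by (metis less_irrefl vec.dim_span vec_dim_card)
  then obtain u0 where u0: "u0 \<notin> vec.span (b ` {..<2 * k})" by blast
  have "proj u0 \<noteq> 0"
  proof
    assume "proj u0 = 0"
    then have "u0 = (\<Sum>i<2 * k. (\<epsilon> i * \<omega> u0 (b (\<tau> i))) *s b i)"
      by (simp add: proj_def)
    also have "\<dots> \<in> vec.span (b ` {..<2 * k})"
      by (intro vec.span_sum vec.span_scale vec.span_base) auto
    finally show False using u0 by blast
  qed
  then obtain v0 where v0: "\<omega> (proj u0) v0 \<noteq> 0"
    using form_nondegenerate by blast
  \<comment> \<open>Projecting the partner keeps the pairing, because \<open>proj u0\<close> is
    orthogonal to every \<open>b i\<close> with \<open>i < 2 * k\<close>.\<close>
  have "\<omega> (proj u0) (proj v0) = \<omega> (proj u0) v0"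
    using orth by (simp add: proj_def[of v0] form_simps)
  define u where "u = proj u0"
  define v where "v = (1 / \<omega> (proj u0) v0) *s proj v0"
  have uv: "\<omega> u v = 1" "\<omega> v u = - 1"
    using \<open>\<omega> (proj u0) (proj v0) = _\<close> v0 form_skew[of v u] by (simp_all add: u_def v_def form_simps)
  have ub: "\<omega> u (b j) = 0" "\<omega> v (b j) = 0" "\<omega> (b j) u = 0" "\<omega> (b j) v = 0" if "j < 2 * k" for j
    using orth[OF that] form_skew[of "b j"] by (simp_all add: u_def v_def form_simps)
  define b' where "b' = b(2 * k := u, Suc (2 * k) := v)"
  have "\<omega> (b' i) (b' j) = standard_form i j" if "i < 2 * Suc k" "j < 2 * Suc k" for i j
  proof -
    have "i < 2 * k \<or> i = 2 * k \<or> i = Suc (2 * k)" "j < 2 * k \<or> j = 2 * k \<or> j = Suc (2 * k)"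
      using that by auto
    then show ?thesis
      by (elim disjE) (auto simp: b'_def b uv ub form_simps standard_form_def, presburger+)
  qed
  then show ?case by blast
qed simp

text \<open>Reindexes the family by \<open>'n\<close> and records only which pairings vanish; their
  values are later absorbed by the transvection parameter.\<close>

lemma symplectic_basis:
  assumes "CARD('n) = 2 * s"
  shows "\<exists>(b :: 'n \<Rightarrow> complex ^ 'n) \<tau>. \<forall>i. \<tau> i \<noteq> i \<and> (\<forall>j. \<omega> (b i) (b j) \<noteq> 0 \<longleftrightarrow> j = \<tau> i)"
proof -
  obtain b :: "nat \<Rightarrow> complex ^ 'n"
    where b: "\<And>i j. i < 2 * s \<Longrightarrow> j < 2 * s \<Longrightarrow> \<omega> (b i) (b j) = standard_form i j"
    using symplectic_family[of s] assms by auto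
  obtain h where h: "bij_betw h (UNIV :: 'n set) {0..<2 * s}"
    using ex_bij_betw_finite_nat[of "UNIV :: 'n set"] assms by auto
  have hs: "h i < 2 * s" for i
    using bij_betwE[OF h] by auto
  have inj: "h i = h j \<longleftrightarrow> i = j" for i j
    using h by (auto simp: bij_betw_def inj_on_def)
  have "\<exists>j. j \<noteq> i \<and> (\<forall>k. \<omega> (b (h i)) (b (h k)) \<noteq> 0 \<longleftrightarrow> k = j)" for i
  proof -
    define m where "m = (if even (h i) then Suc (h i) else h i - 1)"
    have "m < 2 * s"
      using hs[of i] by (auto simp: m_def elim!: evenE)
    then obtain j where j: "h j = m"
      using h unfolding bij_betw_def by (metis atLeastLessThan_iff imageE le0)
    have "m \<noteq> h i"
      by (auto simp: m_def elim: oddE)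
    moreover have "\<omega> (b (h i)) (b (h k)) \<noteq> 0 \<longleftrightarrow> h k = m" for k
      unfolding b[OF hs hs] by (auto simp: standard_form_def m_def elim: oddE)
    ultimately show ?thesis
      using j inj by (intro exI[of _ j]) auto
  qed
  then show ?thesis
    by (intro exI[of _ "\<lambda>i. b (h i)"] choice) blast
qed

text \<open>In coordinates of a symplectic basis the symplectic transvections along basis vectors
  become elementary. The action preserves both homogeneity and \<open>lci p\<close>, so the result
  can be carried back.\<close>

lemma Sp_invariant_in_lci:
  assumes card: "CARD('n) = 2 * s" and inv: "is_invariant (Sp_group \<omega>) f"
    and hom: "homogeneous_of_degree d f" and d: "d > CARD('n) * (p - 1)"
  shows "f \<in> lci p"
proof -
  obtain b :: "'n \<Rightarrow> complex ^ 'n" and \<tau> where \<tau>: "\<And>i. \<tau> i \<noteq> i"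
    and b: "\<And>i j. \<omega> (b i) (b j) \<noteq> 0 \<longleftrightarrow> j = \<tau> i"
    using symplectic_basis[OF card] by blast
  have \<tau>\<tau>: "\<tau> (\<tau> i) = i" for i
    using b[of i "\<tau> i"] b[of "\<tau> i" i] form_skew[of "b i"] by auto
  define H :: "complex ^ 'n ^ 'n" where "H = (\<chi> i j. b j $ i)"
  have col: "column i H = b i" for i
    by (simp add: H_def column_def vec_eq_iff)
  have "v = 0" if "H *v v = 0" for v
  proof -
    have "v $ j = 0" for j
    proof -
      \<comment> \<open>Pairing with \<open>b (\<tau> j)\<close> isolates the coefficient of
        \<open>b j\<close>.\<close>
      have "0 = \<omega> (H *v v) (b (\<tau> j))"
        by (simp add: that form_simps)
      also have "\<dots> = (\<Sum>i\<in>UNIV. if i = j then v $ j * \<omega> (b j) (b (\<tau> j)) else 0)"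
        unfolding matrix_mult_sum col form_simps using b \<tau>\<tau> by (intro sum.cong refl) (metis mult_zero_right)
      finally show ?thesis using b[of j "\<tau> j"] by simp
    qed
    then show ?thesis by (simp add: vec_eq_iff)
  qed
  then obtain H' where H'H: "H' ** H = mat 1"
    using matrix_left_invertible_ker by blast
  then have HH': "H ** H' = mat 1"
    using matrix_left_right_inverse by blast
  let ?f = "fa_act H' f"
  have "fa_shift i (\<tau> i) ?f = 0" for i
  proof -
    obtain g where g: "\<And>c. g c \<in> Sp_group \<omega>" "\<And>c v. g c *v v = v + (c * \<omega> v (b (\<tau> i))) *s b (\<tau> i)"
      using transvection_in_Sp[of _ "b (\<tau> i)"] by metis
    \<comment> \<open>Conjugation expresses the transvection in the new coordinates; the division
      makes its coefficient equal to \<open>c\<close>.\<close>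
    define T where "T c = H' ** g (c / \<omega> (b i) (b (\<tau> i))) ** H" for c
    have Hb: "H' *v b j = axis j 1" for j
    proof -
      have "H' *v (H *v axis j 1) = axis j 1"
        by (simp add: matrix_vector_mul_assoc H'H)
      then show ?thesis by (simp add: matrix_vector_mult_axis col)
    qed
    show ?thesis
    proof (rule transvection_invariant_imp_shift_eq_0)
      fix c
      have "fa_act (T c) ?f = fa_act H' (fa_act (g (c / \<omega> (b i) (b (\<tau> i)))) f)"
        by (simp add: T_def fa_act_act matrix_mul_assoc[symmetric] HH')
      then show "fa_act (T c) ?f = ?f"
        using inv g(1) by (simp add: is_invariant_def)
      fix j
      have "T c *v axis j 1 = H' *v (g (c / \<omega> (b i) (b (\<tau> i))) *v b j)"
        by (simp only: T_def matrix_vector_mul_assoc[symmetric]) (simp only: matrix_vector_mult_axis col)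
      also have "\<dots> = axis j 1 + (c / \<omega> (b i) (b (\<tau> i)) * \<omega> (b j) (b (\<tau> i))) *s axis (\<tau> i) 1"
        by (simp add: g(2) matrix_vector_right_distrib vec.scale Hb)
      also have "\<dots> = axis j 1 + (if j = i then c *s axis (\<tau> i) 1 else 0)"
        using b[of j "\<tau> i"] \<tau>\<tau> by (cases "j = i") (auto, metis)
      finally show "T c *v axis j 1 = axis j 1 + (if j = i then c *s axis (\<tau> i) 1 else 0)" .
    qed
  qed
  then have "?f \<in> lci p"
    using shift_invariants_in_lci[OF homogeneous_act[OF hom] d] \<tau> by blast
  then have "fa_act H ?f \<in> lci p"
    by (rule fa_act_lci)
  then show ?thesis
    by (simp add: fa_act_act HH' fa_act_mat_1)
qed

end

theorem theorem5p2:
  fixes G :: "(complex ^ 'n ^ 'n::finite) set"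
    and f :: "'n free_alg"
    and p d :: nat
  assumes n: "CARD('n) \<ge> 2"
    and G: "G = SL_group \<or>
            (\<exists>s \<omega>. CARD('n) = 2 * s \<and> symplectic_form \<omega> \<and> G = Sp_group \<omega>)"
    and p: "p \<ge> 1"
    and invariant: "is_invariant G f"
    and homogeneous: "homogeneous_of_degree d f"
    and degree: "d > CARD('n) * (p - 1)"
  shows "f \<in> comm_ideal (p + 1)"
proof -
  have "f \<in> lci p"
    using G
  proof (elim disjE exE conjE)
    assume SL: "G = SL_group"
    \<comment> \<open>A second generator serves as the target of the transvection.\<close>
    have "\<exists>j. j \<noteq> i" for i :: 'n
    proof (rule ccontr)
      assume "\<not> ?thesis"
      then have "(UNIV :: 'n set) = {i}" by blast
      from arg_cong[OF this, of card] show False using n by simp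
    qed
    then show ?thesis
      using SL_invariant_imp_shift_eq_0[OF invariant[unfolded SL]]
      by (intro shift_invariants_in_lci[OF homogeneous degree]) blast
  next
    fix s and \<omega> :: "complex ^ 'n \<Rightarrow> complex ^ 'n \<Rightarrow> complex"
    assume "CARD('n) = 2 * s" "symplectic_form \<omega>" "G = Sp_group \<omega>"
    then show ?thesis
      using Sp_invariant_in_lci invariant homogeneous degree by blast
  qed
  then show ?thesis
    using lci_subset_generated_ideal by (auto simp: comm_ideal_def)
qed

end
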